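(* Let $k,n$ be positive integers with $k+2\le n$ and let $Z\in\mathrm{Mat}^{>0}_{n,k+2}$. Let $\mathcal T$ be a bicolored triangulation of type $(k,n)$. Then $$Z^\circ_{\hat G(\overline{\mathcal T})}=\{Y\in\mathrm{Gr}_{k,k+2}\ :\ \mathrm{sgn}\langle Yij\rangle=(-1)^{\mathrm{area}(i\to j)}\text{ for all black arcs } i\to j \text{ of }\mathcal T\text{ with } i<j\}.$$ Moreover, if $Y\in Z^\circ_{\hat G(\overline{\mathcal T})}$, then the twistor coordinate matrix $C':=C^{\mathrm{tw}}_{\mathcal T}(Y)$ lies in (i.e. represents a point of) the positroid cell $S_{\hat G(\mathcal T)}$, and $Y$ and $C'Z$ represent the same element of $\mathrm{Gr}_{k,k+2}$.
   Context: $\mathrm{Gr}_{k,n}$ is the Grassmannian of $k$-dimensional subspaces of $\mathbb R^n$, whose elements are represented by full-rank $k\times n$ real matrices (via row span). For $I\in\binom{[n]}{k}$, $p_I$ denotes the maximal minor in columns $I$ (Plücker coordinate, defined up to a common nonzero scalar). $\mathrm{Gr}_{k,n}^{\ge0}$ is the set of points having a representative with all $p_I\ge 0$. For $\mathcal M\subseteq\binom{[n]}{k}$, let $S_{\mathcal M}$ be the set of points of $\mathrm{Gr}^{\ge0}_{k,n}$ with $p_I>0$ for $I\in\mathcal M$ and $p_I=0$ for $I\notin\mathcal M$; when nonempty it is a positroid cell. $\mathrm{Mat}^{>0}_{n,k+2}$ is the set of real $n\times(k+2)$ matrices with all maximal minors positive; the rows of $Z$ are $Z_1,\dots,Z_n$.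 $Z$ induces a well-defined map $\tilde Z:\mathrm{Gr}^{\ge0}_{k,n}\to\mathrm{Gr}_{k,k+2}$, $C\mapsto CZ$. Twistor coordinates: for $Y\in\mathrm{Gr}_{k,k+2}$ represented by a matrix with rows $y_1,\dots,y_k$, $\langle Yij\rangle=\langle YZ_iZ_j\rangle$ is the determinant of the matrix with rows $y_1,\dots,y_k,Z_i,Z_j$. These are defined up to a common nonzero scalar; a list of sign conditions on $Y$ is understood to hold if it holds for some matrix representative of $Y$ (the same one for all conditions). Let $\mathbf P_n$ be a convex $n$-gon with vertices labeled $1,\dots,n$ clockwise. A bicolored triangulation $\mathcal T$ of type $(k,n)$ is a triangulation of $\mathbf P_n$ in which $k$ triangles are black and the rest white; erasing diagonals separating triangles of the same color gives the bicolored subdivision $\overline{\mathcal T}$. An arc $i\to j$ is a black arc of $\mathcal T$ if it is a side of a black triangle of $\mathcal T$. $\mathrm{area}(i\to j)$ is the number of black triangles of $\mathcal T$ to the left of $i\to j$, i.e. on the side of the arc containing the vertices $i,i+1,\dots,j$ (cyclically). The cell $S_{\hat G(\mathcal T)}\subset\mathrm{Gr}_{k,n}^{\ge0}$ is $S_{\mathcal M}$ where $\mathcal M$ consists of all $I\in\binom{[n]}{k}$ for which there is a bijection $\phi$ from $I$ to the set of black triangles of $\mathcal T$ with $i$ a vertex of $\phi(i)$ for each $i\in I$. It depends only on $\overline{\mathcal T}$. Its image is $Z^\circ_{\hat G(\overline{\mathcal T})}:=\tilde Z(S_{\hat G(\mathcal T)})$. Twistor coordinate matrix: let the black triangles of $\mathcal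 T$ be $\{a_i<b_i<c_i\}$, $i=1,\dots,k$, listed in lexicographically increasing order. $C^{\mathrm{tw}}_{\mathcal T}(Y)$ is the $k\times n$ matrix whose $i$th row has entries $\langle Yb_ic_i\rangle$ in column $a_i$, $-\langle Ya_ic_i\rangle$ in column $b_i$, $\langle Ya_ib_i\rangle$ in column $c_i$, and $0$ elsewhere. *)

theory Defs
  imports Complex_Main "Jordan_Normal_Form.DL_Rank" "Jordan_Normal_Form.DL_Submatrix"
begin

text \<open>
  Vectors and matrices are those of Jordan_Normal_Form, whose indices start at 0.  Accordingly the
  ground set $[n]$ and the vertices of the $n$-gon are \<open>{..<n}\<close>, with label \<open>i\<close> here being label
  \<open>i + 1\<close> in the usual numbering; this preserves the linear and the cyclic order of the labels.
\<close>

section \<open>Grassmannians and the map induced by Z\<close>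

definition Gr :: "nat \<Rightarrow> nat \<Rightarrow> real vec set set" where
  "Gr k m = {V. VectorSpace.subspace class_ring V (module_vec TYPE(real) m) \<and>
     vectorspace.dim class_ring ((module_vec TYPE(real) m)\<lparr>carrier := V\<rparr>) = k}"

text \<open>Since \<open>V\<close> has dimension \<open>k\<close>, a \<open>k \<times> m\<close> matrix representing it has full rank.\<close>

definition represents :: "nat \<Rightarrow> nat \<Rightarrow> real mat \<Rightarrow> real vec set \<Rightarrow> bool" where
  "represents k m A V \<longleftrightarrow> A \<in> carrier_mat k m \<and> V \<in> Gr k m \<and> vec_space.row_space m A = V"

definition plucker :: "real mat \<Rightarrow> nat set \<Rightarrow> real" where
  "plucker A I = det (submatrix A UNIV I)"

definition Gr_nonneg :: "nat \<Rightarrow> nat \<Rightarrow> real vec set set" where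
  "Gr_nonneg k n = {V \<in> Gr k n. \<exists>A. represents k n A V \<and>
     (\<forall>I. I \<subseteq> {..<n} \<and> card I = k \<longrightarrow> plucker A I \<ge> 0)}"

definition positroid_cell :: "nat \<Rightarrow> nat \<Rightarrow> nat set set \<Rightarrow> real vec set set" where
  "positroid_cell k n M = {V \<in> Gr_nonneg k n. \<exists>A. represents k n A V \<and>
     (\<forall>I. I \<subseteq> {..<n} \<and> card I = k \<longrightarrow>
        (I \<in> M \<longrightarrow> plucker A I > 0) \<and> (I \<notin> M \<longrightarrow> plucker A I = 0))}"

definition Mat_pos :: "nat \<Rightarrow> nat \<Rightarrow> real mat set" where
  "Mat_pos n m = {Z \<in> carrier_mat n m.
     \<forall>I. I \<subseteq> {..<n} \<and> card I = m \<longrightarrow> det (submatrix Z I UNIV) > 0}"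

text \<open>
  On subspaces the map \<open>C \<mapsto> C * Z\<close> sends a row vector \<open>v\<close> to \<open>v Z\<close>; with column vectors this is
  multiplication by the transpose of \<open>Z\<close>.  The lemma below confirms that it agrees with multiplying
  matrix representatives by \<open>Z\<close>.
\<close>

definition Z_tilde :: "real mat \<Rightarrow> real vec set \<Rightarrow> real vec set" where
  "Z_tilde Z V = (\<lambda>v. Z\<^sup>T *\<^sub>v v) ` V"

lemma Z_tilde_represents:
  assumes "represents k n C V" and Z: "Z \<in> carrier_mat n m"
  shows "Z_tilde Z V = vec_space.row_space m (C * Z)"
proof -
  have C: "C \<in> carrier_mat k n" and V: "V = vec_space.row_space n C"
    using assms by (auto simp: represents_def)
  have CZ: "C * Z \<in> carrier_mat k m" using C Z by simp
  have row_space: "vec_space.row_space q A = (\<lambda>y. A\<^sup>T *\<^sub>v y) ` carrier_vec k"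
    if "A \<in> carrier_mat k q" for q and A :: "real mat"
    unfolding vec_space.row_space_eq[OF that] carrier_matD[OF that]
    using mult_mat_vec_carrier[OF transpose_carrier_mat[THEN iffD2, OF that]] by blast
  have "Z\<^sup>T *\<^sub>v (C\<^sup>T *\<^sub>v y) = (C * Z)\<^sup>T *\<^sub>v y" if "y \<in> carrier_vec k" for y
    unfolding transpose_mult[OF C Z]
    using assoc_mult_mat_vec[OF transpose_carrier_mat[THEN iffD2, OF Z]
        transpose_carrier_mat[THEN iffD2, OF C] that] by (rule sym)
  then show ?thesis
    unfolding Z_tilde_def V row_space[OF C] row_space[OF CZ] image_image
    by (rule image_cong[OF refl])
qed

section \<open>Bicolored triangulations\<close>

text \<open>
  Chords of the convex \<open>n\<close>-gon are two-element sets of vertices and triangles are three-element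
  sets of vertices.  Two chords meet in an interior point exactly if their endpoints are distinct
  and alternate along the boundary.
\<close>

definition crossing :: "nat set \<Rightarrow> nat set \<Rightarrow> bool" where
  "crossing e f \<longleftrightarrow> (\<exists>a b c d. a < b \<and> b < c \<and> c < d \<and>
     (e = {a, c} \<and> f = {b, d} \<or> e = {b, d} \<and> f = {a, c}))"

definition polygon_sides :: "nat \<Rightarrow> nat set set" where
  "polygon_sides n = {{i, Suc i mod n} | i. i < n}"

definition diagonals :: "nat \<Rightarrow> nat set set" where
  "diagonals n = {{i, j} | i j. i < n \<and> j < n \<and> i \<noteq> j} - polygon_sides n"

text \<open>A triangulation is given by its set \<open>D\<close> of diagonals.\<close>

definition triangulation :: "nat \<Rightarrow> nat set set \<Rightarrow> bool" where
  "triangulation n D \<longleftrightarrow> D \<subseteq> diagonals n \<and>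
     (\<forall>e\<in>D. \<forall>f\<in>D. \<not> crossing e f) \<and>
     (\<forall>e\<in>diagonals n - D. \<exists>f\<in>D. crossing e f)"

definition triangles :: "nat \<Rightarrow> nat set set \<Rightarrow> nat set set" where
  "triangles n D = {{a, b, c} | a b c. a < b \<and> b < c \<and> c < n \<and>
     {{a, b}, {b, c}, {a, c}} \<subseteq> D \<union> polygon_sides n}"

text \<open>\<open>B\<close> is the set of black triangles; all other triangles are white.\<close>

definition bicolored_triangulation :: "nat \<Rightarrow> nat \<Rightarrow> nat set set \<Rightarrow> nat set set \<Rightarrow> bool" where
  "bicolored_triangulation k n D B \<longleftrightarrow>
     triangulation n D \<and> B \<subseteq> triangles n D \<and> card B = k"

definition black_arc :: "nat set set \<Rightarrow> nat \<Rightarrow> nat \<Rightarrow> bool" where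
  "black_arc B i j \<longleftrightarrow> i \<noteq> j \<and> (\<exists>t\<in>B. {i, j} \<subseteq> t)"

definition left_vertices :: "nat \<Rightarrow> nat \<Rightarrow> nat \<Rightarrow> nat set" where
  "left_vertices n i j = (if i \<le> j then {i..j} else {i..<n} \<union> {..j})"

definition area :: "nat \<Rightarrow> nat set set \<Rightarrow> nat \<Rightarrow> nat \<Rightarrow> nat" where
  "area n B i j = card {t \<in> B. t \<subseteq> left_vertices n i j}"

definition black_matchings :: "nat \<Rightarrow> nat set set \<Rightarrow> nat set set" where
  "black_matchings n B = {I. I \<subseteq> {..<n} \<and> (\<exists>\<phi>. bij_betw \<phi> I B \<and> (\<forall>i\<in>I. i \<in> \<phi> i))}"

definition cell_G :: "nat \<Rightarrow> nat \<Rightarrow> nat set set \<Rightarrow> real vec set set" where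
  "cell_G k n B = positroid_cell k n (black_matchings n B)"

definition Z_image_G :: "nat \<Rightarrow> nat \<Rightarrow> real mat \<Rightarrow> nat set set \<Rightarrow> real vec set set" where
  "Z_image_G k n Z B = Z_tilde Z ` cell_G k n B"

section \<open>Twistor coordinates\<close>

text \<open>Here and below \<open>A\<close> is a matrix representative of the point \<open>Y\<close> of the Grassmannian.\<close>

definition twistor :: "real mat \<Rightarrow> real mat \<Rightarrow> nat \<Rightarrow> nat \<Rightarrow> real" where
  "twistor Z A i j = det (mat_of_rows (dim_col Z) (rows A @ [row Z i, row Z j]))"

text \<open>The nested enumeration lists the triples \<open>a < b < c\<close> in lexicographically increasing order.\<close>

definition triangle_list :: "nat \<Rightarrow> nat set set \<Rightarrow> (nat \<times> nat \<times> nat) list" where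
  "triangle_list n B =
     [(a, b, c). a \<leftarrow> [0..<n], b \<leftarrow> [Suc a..<n], c \<leftarrow> [Suc b..<n], {a, b, c} \<in> B]"

lemma set_triangle_list:
  "set (triangle_list n B) = {(a, b, c). a < b \<and> b < c \<and> c < n \<and> {a, b, c} \<in> B}"
  by (auto simp: triangle_list_def)

lemma sorted_wrt_concat_map:
  assumes "\<And>x. x \<in> set xs \<Longrightarrow> sorted_wrt R (f x)"
    and "sorted_wrt (\<lambda>x y. \<forall>u\<in>set (f x). \<forall>v\<in>set (f y). R u v) xs"
  shows "sorted_wrt R (concat (map f xs))"
  using assms by (induction xs) (auto simp: sorted_wrt_append)

lemma sorted_triangle_list:
  "sorted_wrt (\<lambda>s t. (s, t) \<in> less_than <*lex*> less_than <*lex*> less_than) (triangle_list n B)"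
  unfolding triangle_list_def
  apply (intro sorted_wrt_concat_map)
   apply (auto intro!: sorted_wrt_concat_map)
  apply (auto intro!: sorted_wrt_mono_rel[OF _ sorted_wrt_upt])
  done

definition twistor_matrix :: "nat \<Rightarrow> nat \<Rightarrow> real mat \<Rightarrow> nat set set \<Rightarrow> real mat \<Rightarrow> real mat" where
  "twistor_matrix k n Z B A = mat k n (\<lambda>(r, j). case triangle_list n B ! r of (a, b, c) \<Rightarrow>
     if j = a then twistor Z A b c
     else if j = b then - twistor Z A a c
     else if j = c then twistor Z A a b
     else 0)"

end

theory Submission
  imports Defs "Jordan_Normal_Form.DL_Rank_Submatrix"
begin

text \<open>
  Write \<open>p\<^sub>I(C)\<close> for the maximal minor of \<open>C\<close> in the columns \<open>I\<close>, and \<open>Z\<^sub>J\<close> for the rows \<open>J\<close> of \<open>Z\<close>.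
  If \<open>Y\<close> is represented by \<open>C * Z\<close>, then by Cauchy--Binet its twistor coordinate for \<open>i < j\<close> is
  the sum of
    \<open>(- 1) ^ card (I \<inter> {i<..<j}) * p\<^sub>I(C) * det Z\<^sub>J\<close> with \<open>J = I \<union> {i, j}\<close>
  over the \<open>k\<close>-element sets \<open>I\<close> that contain neither \<open>i\<close> nor \<open>j\<close>,
  where all minors of \<open>Z\<close> are positive (\<open>twistor_product_expansion\<close>).

  Let \<open>C\<close> represent a point of the cell, so that only those \<open>I\<close> contribute that can be matched with
  the black triangles.  No triangle crosses a black arc \<open>i \<rightarrow> j\<close>.  In a matching that avoids \<open>i\<close> and \<open>j\<close>
  the triangles to the left of the arc therefore use exactly the elements of \<open>I\<close> strictly between \<open>i\<close>
  and \<open>j\<close>, and their number is the area (\<open>matching_parity\<close>).  So all terms have the sign given by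
  the area.  Some term is nonzero, because assigning to each triangle the vertex that points away
  from the arc is a matching that avoids \<open>i\<close> and \<open>j\<close> (\<open>matching_avoiding_arc\<close>).  This proves that the
  points of the image satisfy the sign conditions (\<open>twistor_sign_of_cell\<close>).

  Conversely, let \<open>A\<close> represent a point \<open>Y\<close> with these signs, and let \<open>C'\<close> be its twistor coordinate
  matrix.  The signs of the entries of \<open>C'\<close> are those of a Kasteleyn matrix: all nonzero terms in the
  Leibniz expansions of all maximal minors have one common sign.  Indeed the sign of a permutation is
  a product over the pairs of rows, and so is the product of the signs of the chosen entries, since an
  area counts triangles.  For two noncrossing triangles the contribution of the pair depends on their
  relative position only, and not on the vertices chosen in them (\<open>separated_pair_sign\<close>).  Hence, up to
  the sign of one row, \<open>C'\<close> has the minors required by the cell (\<open>kasteleyn_plucker\<close>).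

  The row of \<open>C' * Z\<close> that belongs to a triangle \<open>a < b < c\<close> is
  \<open>\<langle>Y b c\<rangle> Z\<^sub>a - \<langle>Y a c\<rangle> Z\<^sub>b + \<langle>Y a b\<rangle> Z\<^sub>c\<close>, which lies in \<open>Y\<close> by Cramer's rule
  (\<open>three_term_in_row_space\<close>).  So \<open>C' * Z = G * A\<close> for a square matrix \<open>G\<close>.  The twistor coordinates
  of \<open>G * A\<close> are those of \<open>A\<close> multiplied by \<open>det G\<close>, and on black arcs they are nonzero by the first
  part.  Thus \<open>G\<close> is invertible and \<open>C' * Z\<close> represents \<open>Y\<close> (\<open>twistor_matrix_in_cell\<close>).  The same
  argument covers every representative of a point of the image, as changing the representative
  multiplies all twistor coordinates by the same nonzero number.
\<close>

section \<open>The sign of a permutation as a product over pairs\<close>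

definition order_sign :: "nat \<Rightarrow> nat \<Rightarrow> int" where
  "order_sign x y = (if x < y then 1 else - 1)"

text \<open>
  For injective \<open>f\<close> this is \<open>- 1\<close> to the number of inversions.  It is kept as a product over pairs,
  since it will be combined with other products over pairs, and it is not restricted to permutations,
  since it will be used for bijections from the row indices to a set of columns.
\<close>

definition inversion_sign :: "nat \<Rightarrow> (nat \<Rightarrow> nat) \<Rightarrow> int" where
  "inversion_sign m f = (\<Prod>s<m. \<Prod>r<s. order_sign (f r) (f s))"

text \<open>
  A permutation of the indices permutes the two-element sets of indices; it may exchange the two
  members of a pair, which a symmetric \<open>w\<close> does not notice.
\<close>

lemma prod_pairs_permute:
  fixes w :: "nat \<Rightarrow> nat \<Rightarrow> 'a::comm_monoid_mult"
  assumes q: "q permutes {..<m}"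
    and sym: "\<And>x y. x < m \<Longrightarrow> y < m \<Longrightarrow> w x y = w y x"
  shows "(\<Prod>s<m. \<Prod>r<s. w (q r) (q s)) = (\<Prod>s<m. \<Prod>r<s. w r s)"
proof -
  define P where "P = (SIGMA s:{..<m}. {..<s})"
  define g where "g = (\<lambda>(s, r). (max (q s) (q r), min (q s) (q r)))"
  have fin: "finite P" by (auto simp: P_def)
  have inj: "q x = q y \<longleftrightarrow> x = y" for x y
    using permutes_inj[OF q] by (auto dest: injD)
  have bound: "x < m \<Longrightarrow> q x < m" for x
    using permutes_in_image[OF q, of x] by simp
  have g_in: "g ` P \<subseteq> P"
  proof
    fix z assume "z \<in> g ` P"
    then obtain s r where "r < s" "s < m" and z: "z = (max (q s) (q r), min (q s) (q r))"
      by (auto simp: P_def g_def)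
    moreover from this have "q s \<noteq> q r" by (simp add: inj)
    ultimately show "z \<in> P" using bound[of s] bound[of r] by (auto simp: P_def)
  qed
  have "inj_on g P"
  proof (rule inj_onI)
    fix y z assume yz: "y \<in> P" "z \<in> P" and eq: "g y = g z"
    obtain s r s' r' where *: "y = (s, r)" "z = (s', r')" "r < s" "r' < s'"
      using yz by (auto simp: P_def)
    have "{q s, q r} = {q s', q r'}"
      using eq by (auto simp: * g_def max_def min_def split: if_splits)
    then have "{s, r} = {s', r'}"
      by (auto simp: doubleton_eq_iff inj)
    then show "y = z" using * by (auto simp: doubleton_eq_iff)
  qed
  then have bij: "bij_betw g P P"
    using endo_inj_surj[OF fin g_in] by (simp add: bij_betw_def)
  have "(\<Prod>s<m. \<Prod>r<s. w (q r) (q s)) = (\<Prod>(s, r)\<in>P. w (q r) (q s))"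
    unfolding P_def by (rule prod.Sigma) auto
  also have "\<dots> = (\<Prod>z\<in>P. (\<lambda>(s, r). w r s) (g z))"
  proof (rule prod.cong[OF refl], clarify)
    fix s r assume "(s, r) \<in> P"
    then have "q s < m" "q r < m" using bound by (auto simp: P_def)
    then show "w (q r) (q s) = (case g (s, r) of (s, r) \<Rightarrow> w r s)"
      using sym by (auto simp: g_def max_def min_def)
  qed
  also have "\<dots> = (\<Prod>(s, r)\<in>P. w r s)"
    by (rule prod.reindex_bij_betw[OF bij])
  also have "\<dots> = (\<Prod>s<m. \<Prod>r<s. w r s)"
    unfolding P_def by (rule prod.Sigma[symmetric]) auto
  finally show ?thesis .
qed

text \<open>
  For the pair of values \<open>x, y\<close>, the product of the order sign of \<open>f x, f y\<close> with that of \<open>x, y\<close> is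
  symmetric in \<open>x\<close> and \<open>y\<close>, so its product over all pairs does not change under \<open>q\<close>; what is split off
  is the inversion sign of \<open>q\<close>.
\<close>

lemma inversion_sign_compose:
  assumes q: "q permutes {..<m}" and f: "inj_on f {..<m}"
  shows "inversion_sign m (f \<circ> q) = inversion_sign m f * inversion_sign m q"
proof -
  define w where "w x y = order_sign (f x) (f y) * order_sign x y" for x y
  have sym: "w x y = w y x" if "x < m" "y < m" for x y
    using that inj_on_eq_iff[OF f, of x y] by (auto simp: w_def order_sign_def)
  have square: "order_sign x y * order_sign x y = 1" for x y
    by (simp add: order_sign_def)
  have "inversion_sign m (f \<circ> q) = (\<Prod>s<m. \<Prod>r<s. w (q r) (q s) * order_sign (q r) (q s))"
    unfolding inversion_sign_def w_def by (simp add: mult.assoc square)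
  also have "\<dots> = (\<Prod>s<m. \<Prod>r<s. w (q r) (q s)) * inversion_sign m q"
    unfolding inversion_sign_def by (simp add: prod.distrib)
  also have "(\<Prod>s<m. \<Prod>r<s. w (q r) (q s)) = (\<Prod>s<m. \<Prod>r<s. w r s)"
    by (rule prod_pairs_permute[OF q sym])
  also have "\<dots> = inversion_sign m f"
    unfolding inversion_sign_def w_def
    by (intro prod.cong refl) (simp add: order_sign_def)
  finally show ?thesis .
qed

lemma inversion_sign_mono:
  assumes "\<And>r s. r < s \<Longrightarrow> s < m \<Longrightarrow> f r < f s"
  shows "inversion_sign m f = 1"
  unfolding inversion_sign_def using assms by (intro prod.neutral ballI) (simp add: order_sign_def)

text \<open>
  Exchanging \<open>a < b\<close> reverses the pair \<open>(a, b)\<close> and, for each \<open>x\<close> strictly between, the two pairs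
  \<open>(a, x)\<close> and \<open>(x, b)\<close>: an odd number of pairs.
\<close>

lemma inversion_sign_transpose:
  assumes "a < m" "b < m" "a \<noteq> b"
  shows "inversion_sign m (Transposition.transpose a b) = - 1"
  using assms
proof (induction a b rule: linorder_wlog)
  case (le a b)
  define P where "P = (SIGMA s:{..<m}. {..<s})"
  \<comment> \<open>the reversed pairs, with the larger member first\<close>
  define N where "N = insert (b, a) ((\<lambda>x. (x, a)) ` {a<..<b} \<union> (\<lambda>x. (b, x)) ` {a<..<b})"
  have "card N = 1 + (card ((\<lambda>x. (x, a)) ` {a<..<b}) + card ((\<lambda>x. (b, x)) ` {a<..<b}))"
    unfolding N_def by (subst card_insert_disjoint) (auto intro!: card_Un_disjoint)
  also have "\<dots> = 1 + 2 * card {a<..<b}"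
    by (simp add: card_image inj_on_def)
  finally have odd: "odd (card N)" by simp
  have N: "N \<subseteq> P" using le by (auto simp: N_def P_def)
  have fin: "finite P" by (auto simp: P_def)
  have "inversion_sign m (Transposition.transpose a b) =
      (\<Prod>(s, r)\<in>P. order_sign (Transposition.transpose a b r) (Transposition.transpose a b s))"
    unfolding P_def inversion_sign_def by (rule prod.Sigma) auto
  also have "\<dots> = (\<Prod>z\<in>P. if z \<in> N then - 1 else 1)"
    using le by (intro prod.cong refl)
      (auto simp: P_def N_def order_sign_def Transposition.transpose_def split: if_splits)
  also have "\<dots> = (\<Prod>z\<in>P \<inter> N. - 1)"
    by (rule prod.inter_restrict[OF fin, symmetric])
  also have "\<dots> = - 1" using N odd by (simp add: Int_absorb1)
  finally show ?case .
next
  case (sym a b)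
  then show ?case by (simp add: transpose_commute)
qed

lemma sign_eq_inversion_sign:
  assumes "p permutes {..<m}"
  shows "sign p = inversion_sign m p"
  using assms finite_lessThan
proof (induction rule: permutes_induct)
  case id
  show ?case by (simp add: inversion_sign_mono)
next
  case (swap a b p)
  have "inversion_sign m (Transposition.transpose a b \<circ> p) =
      inversion_sign m (Transposition.transpose a b) * inversion_sign m p"
    by (intro inversion_sign_compose[OF swap(4)] inj_onI) (metis transpose_involutory)
  moreover have "sign (Transposition.transpose a b \<circ> p) = - sign p"
    using swap permutation_permutes
    by (subst sign_compose) (auto simp: permutation_swap_id sign_swap_id)
  moreover have "inversion_sign m (Transposition.transpose a b) = - 1"
    using swap by (intro inversion_sign_transpose) auto
  ultimately show ?case by (simp only: swap(5) mult_minus1)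
qed

section \<open>Maximal minors\<close>

text \<open>
  The bijections from \<open>{..<m}\<close> to \<open>I\<close>, made the identity elsewhere so that there are only finitely
  many of them.
\<close>

definition enumerations :: "nat \<Rightarrow> nat set \<Rightarrow> (nat \<Rightarrow> nat) set" where
  "enumerations m I = {f. bij_betw f {..<m} I \<and> (\<forall>i. i \<notin> {..<m} \<longrightarrow> f i = i)}"

lemma submatrix_columns_eq:
  assumes A: "A \<in> carrier_mat m n" and I: "I \<subseteq> {..<n}"
  shows "submatrix A UNIV I = mat m (card I) (\<lambda>(i, j). A $$ (i, pick I j))"
proof -
  have "{j. j < dim_col A \<and> j \<in> I} = I" "{i. i < dim_row A \<and> i \<in> UNIV} = {..<m}"
    using A I by auto
  then show ?thesis unfolding submatrix_def by (simp only: pick_UNIV card_lessThan)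
qed

lemma submatrix_rows_eq:
  assumes Z: "Z \<in> carrier_mat n m" and J: "J \<subseteq> {..<n}"
  shows "submatrix Z J UNIV = mat (card J) m (\<lambda>(i, j). Z $$ (pick J i, j))"
proof -
  have "{i. i < dim_row Z \<and> i \<in> J} = J" "{j. j < dim_col Z \<and> j \<in> UNIV} = {..<m}"
    using Z J by auto
  then show ?thesis unfolding submatrix_def by (simp only: pick_UNIV card_lessThan)
qed

lemma pick_bounded:
  assumes "I \<subseteq> {..<n}" "j < card I"
  shows "pick I j < n"
  using pick_in_set_le[OF assms(2)] assms(1) by auto

lemma pick_bij_betw:
  assumes fin: "finite I" and "card I = m"
  shows "bij_betw (pick I) {..<m} I"
proof -
  have inj: "inj_on (pick I) {..<m}"
    using pick_mono_le[of _ I] assms(2)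
    by (intro inj_onI) (metis lessThan_iff less_irrefl linorder_neqE_nat)
  have "pick I ` {..<m} \<subseteq> I" using pick_in_set_le[of _ I] assms(2) by auto
  then have "pick I ` {..<m} = I"
    using card_image[OF inj] fin assms(2) by (intro card_subset_eq) auto
  with inj show ?thesis by (simp add: bij_betw_def)
qed

text \<open>
  Composition with the increasing enumeration \<open>pick I\<close> turns permutations into enumerations.  As
  \<open>pick I\<close> preserves the order, it preserves inversion signs (\<open>inversion_sign_pick\<close>).
\<close>

lemma bij_betw_permutations_enumerations:
  assumes I: "finite I" "card I = m"
  shows "bij_betw (\<lambda>p i. if i < m then pick I (p i) else i) {p. p permutes {..<m}} (enumerations m I)"
proof -
  have pick: "bij_betw (pick I) {..<m} I" by (rule pick_bij_betw[OF I])
  define e where "e = the_inv_into {..<m} (pick I)"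
  have e: "bij_betw e I {..<m}" unfolding e_def by (rule bij_betw_the_inv_into[OF pick])
  have e1: "e (pick I x) = x" if "x < m" for x
    unfolding e_def using pick that by (intro the_inv_into_f_f) (auto simp: bij_betw_def)
  have e2: "pick I (e x) = x" if "x \<in> I" for x
    unfolding e_def using pick that by (intro f_the_inv_into_f) (auto simp: bij_betw_def)
  show ?thesis
  proof (rule bij_betw_byWitness[where f' = "\<lambda>f i. if i < m then e (f i) else i"], safe)
    fix p assume p: "p permutes {..<m}"
    show "(\<lambda>i. if i < m then e (if i < m then pick I (p i) else i) else i) = p"
      using permutes_in_image[OF p] permutes_not_in[OF p] by (auto simp: e1)
    have "bij_betw (pick I \<circ> p) {..<m} I"
      using permutes_imp_bij[OF p] pick by (rule bij_betw_trans)
    then have "bij_betw (\<lambda>i. if i < m then pick I (p i) else i) {..<m} I"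
      by (rule bij_betw_cong[THEN iffD1, rotated]) simp
    then show "(\<lambda>i. if i < m then pick I (p i) else i) \<in> enumerations m I"
      by (simp add: enumerations_def)
  next
    fix f assume f: "f \<in> enumerations m I"
    then have b: "bij_betw f {..<m} I" by (simp add: enumerations_def)
    show "(\<lambda>i. if i < m then pick I (if i < m then e (f i) else i) else i) = f"
      using f bij_betwE[OF b] by (auto simp: e2 enumerations_def)
    have "bij_betw (e \<circ> f) {..<m} {..<m}"
      using b e by (rule bij_betw_trans)
    then have "bij_betw (\<lambda>i. if i < m then e (f i) else i) {..<m} {..<m}"
      by (rule bij_betw_cong[THEN iffD1, rotated]) simp
    then show "(\<lambda>i. if i < m then e (f i) else i) permutes {..<m}"
      by (rule bij_imp_permutes) simp
  qed
qed

lemma finite_enumerations: "finite I \<Longrightarrow> card I = m \<Longrightarrow> finite (enumerations m I)"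
  using bij_betw_finite[OF bij_betw_permutations_enumerations, of I m]
  by (simp add: finite_permutations)

lemma inversion_sign_pick:
  assumes I: "finite I" "card I = m" and p: "p permutes {..<m}"
  shows "inversion_sign m (\<lambda>i. if i < m then pick I (p i) else i) = sign p"
proof -
  have "inversion_sign m (\<lambda>i. if i < m then pick I (p i) else i) = inversion_sign m (pick I \<circ> p)"
    by (auto simp: inversion_sign_def intro!: prod.cong)
  also have "\<dots> = inversion_sign m (pick I) * inversion_sign m p"
    using pick_bij_betw[OF I] by (intro inversion_sign_compose p) (auto simp: bij_betw_def)
  also have "inversion_sign m (pick I) = 1"
    using pick_mono_le I by (intro inversion_sign_mono) auto
  finally show ?thesis by (simp add: sign_eq_inversion_sign[OF p])
qed

text \<open>
  The Leibniz formula for a maximal minor, indexed by the matchings of rows with columns themselves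
  instead of permutations.  In this form a combinatorial description of the nonzero entries can be
  used directly.
\<close>

lemma det_submatrix_columns:
  fixes A :: "'a::comm_ring_1 mat"
  assumes A: "A \<in> carrier_mat m n" and I: "I \<subseteq> {..<n}" "card I = m"
  shows "det (submatrix A UNIV I) =
    (\<Sum>f\<in>enumerations m I. of_int (inversion_sign m f) * (\<Prod>r<m. A $$ (r, f r)))"
proof -
  have fin: "finite I" using I finite_subset by blast
  have S: "submatrix A UNIV I = mat m m (\<lambda>(i, j). A $$ (i, pick I j))"
    using submatrix_columns_eq[OF A I(1)] by (simp only: I(2))
  have "det (submatrix A UNIV I) =
      (\<Sum>p | p permutes {..<m}. signof p * (\<Prod>r<m. A $$ (r, pick I (p r))))"
    unfolding S by (subst det_def'[of _ m])
      (auto simp: lessThan_atLeast0 permutes_in_image intro!: sum.cong prod.cong)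
  also have "\<dots> = (\<Sum>p | p permutes {..<m}.
      (\<lambda>f. of_int (inversion_sign m f) * (\<Prod>r<m. A $$ (r, f r)))
        (\<lambda>i. if i < m then pick I (p i) else i))"
    by (intro sum.cong refl) (simp add: inversion_sign_pick[OF fin I(2)])
  also have "\<dots> = (\<Sum>f\<in>enumerations m I. of_int (inversion_sign m f) * (\<Prod>r<m. A $$ (r, f r)))"
    by (rule sum.reindex_bij_betw[OF bij_betw_permutations_enumerations[OF fin I(2)]])
  finally show ?thesis .
qed

lemma det_selected_rows:
  fixes Z :: "'a::comm_ring_1 mat"
  assumes Z: "Z \<in> carrier_mat n m" and J: "J \<subseteq> {..<n}" "card J = m"
    and f: "f \<in> enumerations m J"
  shows "det (mat m m (\<lambda>(i, j). Z $$ (f i, j))) =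
    of_int (inversion_sign m f) * det (submatrix Z J UNIV)"
proof -
  have fin: "finite J" using J finite_subset by blast
  obtain p where p: "p permutes {..<m}" and f_eq: "f = (\<lambda>i. if i < m then pick J (p i) else i)"
    using f bij_betw_permutations_enumerations[OF fin J(2)] by (auto simp: bij_betw_def)
  have S: "submatrix Z J UNIV = mat m m (\<lambda>(i, j). Z $$ (pick J i, j))"
    using submatrix_rows_eq[OF Z J(1)] by (simp only: J(2))
  have "mat m m (\<lambda>(i, j). Z $$ (f i, j)) = mat m m (\<lambda>(i, j). submatrix Z J UNIV $$ (p i, j))"
    using permutes_in_image[OF p] by (intro eq_matI) (auto simp: f_eq S)
  also have "det \<dots> = signof p * det (submatrix Z J UNIV)"
    using p by (intro det_permute_rows) (auto simp: S lessThan_atLeast0)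
  finally show ?thesis using inversion_sign_pick[OF fin J(2) p] by (simp add: f_eq)
qed


text \<open>
  Every row of \<open>A * Z\<close> is a combination of rows of \<open>Z\<close>.  In the multilinear expansion of the
  determinant a choice of rows with a repetition contributes nothing, and the choices with image \<open>J\<close>
  add up to the minor of \<open>A\<close> in the columns \<open>J\<close> times that of \<open>Z\<close> in the rows \<open>J\<close>.
\<close>

lemma Cauchy_Binet:
  fixes A Z :: "'a::comm_ring_1 mat"
  assumes A: "A \<in> carrier_mat m n" and Z: "Z \<in> carrier_mat n m"
  shows "det (A * Z) =
    (\<Sum>J | J \<subseteq> {..<n} \<and> card J = m. det (submatrix A UNIV J) * det (submatrix Z J UNIV))"
proof -
  define F where "F = {f. (\<forall>i\<in>{0..<m}. f i \<in> {0..<n}) \<and> (\<forall>i. i \<notin> {0..<m} \<longrightarrow> f i = i)}"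
  define F' where "F' = {f \<in> F. inj_on f {..<m}}"
  define \<J> where "\<J> = {J. J \<subseteq> {..<n} \<and> card J = m}"
  define D where "D f = det (mat m m (\<lambda>(i, j). Z $$ (f i, j)))" for f :: "nat \<Rightarrow> nat"
  have finF: "finite F" unfolding F_def by (rule finite_bounded_functions) auto
  have fin\<J>: "finite \<J>" unfolding \<J>_def by simp
  have AZ: "A * Z = mat\<^sub>r m m (\<lambda>i. finsum_vec TYPE('a) m (\<lambda>l. A $$ (i, l) \<cdot>\<^sub>v row Z l) {0..<n})"
    using A Z
    by (intro eq_matI) (auto simp: index_finsum_vec scalar_prod_def intro!: sum.cong)
  have rows: "mat\<^sub>r m m (\<lambda>i. row Z (f i)) = mat m m (\<lambda>(i, j). Z $$ (f i, j))" if "f \<in> F" for f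
    using that Z by (intro eq_matI) (auto simp: F_def)
  have "det (A * Z) = (\<Sum>f\<in>F. det (mat\<^sub>r m m (\<lambda>i. A $$ (i, f i) \<cdot>\<^sub>v row Z (f i))))"
    unfolding AZ F_def using Z by (intro det_linear_rows_sum) auto
  also have "\<dots> = (\<Sum>f\<in>F. (\<Prod>r<m. A $$ (r, f r)) * D f)"
  proof (intro sum.cong refl)
    fix f assume "f \<in> F"
    then show "det (mat\<^sub>r m m (\<lambda>i. A $$ (i, f i) \<cdot>\<^sub>v row Z (f i))) = (\<Prod>r<m. A $$ (r, f r)) * D f"
      using Z by (subst det_rows_mul) (auto simp: rows D_def lessThan_atLeast0)
  qed
  also have "\<dots> = (\<Sum>f\<in>F'. (\<Prod>r<m. A $$ (r, f r)) * D f)"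
  proof (rule sum.mono_neutral_right[OF finF])
    show "\<forall>f\<in>F - F'. (\<Prod>r<m. A $$ (r, f r)) * D f = 0"
    proof
      fix f assume "f \<in> F - F'"
      then obtain r s where "r < m" "s < m" "r \<noteq> s" "f r = f s"
        by (auto simp: F'_def inj_on_def)
      then have "D f = 0"
        unfolding D_def by (intro det_identical_rows[of _ m r s]) (auto intro!: eq_vecI)
      then show "(\<Prod>r<m. A $$ (r, f r)) * D f = 0" by simp
    qed
  qed (auto simp: F'_def)
  also have "\<dots> = (\<Sum>J\<in>\<J>. \<Sum>f | f \<in> F' \<and> f ` {..<m} = J. (\<Prod>r<m. A $$ (r, f r)) * D f)"
  proof (rule sum.group[symmetric])
    show "finite F'" using finF by (simp add: F'_def)
    show "(\<lambda>f. f ` {..<m}) ` F' \<subseteq> \<J>"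
      by (auto simp: F'_def F_def \<J>_def card_image)
  qed (fact fin\<J>)
  also have "\<dots> = (\<Sum>J\<in>\<J>. det (submatrix A UNIV J) * det (submatrix Z J UNIV))"
  proof (intro sum.cong refl)
    fix J assume "J \<in> \<J>"
    then have J: "J \<subseteq> {..<n}" "card J = m" by (auto simp: \<J>_def)
    have "{f. f \<in> F' \<and> f ` {..<m} = J} = enumerations m J"
      using J by (auto simp: F'_def F_def enumerations_def bij_betw_def)
    then have "(\<Sum>f | f \<in> F' \<and> f ` {..<m} = J. (\<Prod>r<m. A $$ (r, f r)) * D f) =
        (\<Sum>f\<in>enumerations m J. of_int (inversion_sign m f) * (\<Prod>r<m. A $$ (r, f r))
          * det (submatrix Z J UNIV))"
      by (intro sum.cong) (auto simp: D_def det_selected_rows[OF Z J])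
    then show "(\<Sum>f | f \<in> F' \<and> f ` {..<m} = J. (\<Prod>r<m. A $$ (r, f r)) * D f) =
        det (submatrix A UNIV J) * det (submatrix Z J UNIV)"
      unfolding det_submatrix_columns[OF A J] sum_distrib_right by simp
  qed
  finally show ?thesis unfolding \<J>_def .
qed

text \<open>
  Multiplied by \<open>Z\<close> from the right, the new row becomes row \<open>j\<close> of \<open>Z\<close>.  In this way a twistor
  coordinate of \<open>C * Z\<close> is the determinant of a product.
\<close>

definition append_unit_row :: "'a::comm_ring_1 mat \<Rightarrow> nat \<Rightarrow> 'a mat" where
  "append_unit_row A j = mat (Suc (dim_row A)) (dim_col A)
     (\<lambda>(r, c). if r < dim_row A then A $$ (r, c) else if c = j then 1 else 0)"

lemma enumerations_Suc:
  assumes I: "finite I" "card I = Suc m" and j: "j \<in> I"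
  shows "bij_betw (\<lambda>f. f(m := j)) (enumerations m (I - {j})) {f \<in> enumerations (Suc m) I. f m = j}"
proof (rule bij_betw_byWitness[where f' = "\<lambda>f. f(m := m)"], safe)
  fix f assume "f \<in> enumerations m (I - {j})"
  then have b: "bij_betw f {..<m} (I - {j})" and out: "\<And>i. i \<notin> {..<m} \<Longrightarrow> f i = i"
    by (auto simp: enumerations_def)
  show "(f(m := j))(m := m) = f" using out[of m] by auto
  have "bij_betw (f(m := j)) {..<m} (I - {j})"
    using b by (rule bij_betw_cong[THEN iffD1, rotated]) simp
  moreover have "bij_betw (f(m := j)) {m} {j}" by (simp add: bij_betw_def)
  ultimately have "bij_betw (f(m := j)) ({..<m} \<union> {m}) (I - {j} \<union> {j})"
    by (rule bij_betw_combine) simp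
  moreover have "{..<m} \<union> {m} = {..<Suc m}" "I - {j} \<union> {j} = I" using j by auto
  ultimately show "f(m := j) \<in> enumerations (Suc m) I"
    using out by (simp add: enumerations_def)
  show "(f(m := j)) m = j" by simp
next
  fix f assume f: "f \<in> enumerations (Suc m) I" and j_eq: "j = f m"
  have b: "bij_betw f {..<Suc m} I" using f by (simp add: enumerations_def)
  show "(f(m := m))(m := f m) = f" by simp
  have "bij_betw f ({..<Suc m} - {m}) (I - {f m})"
    using b by (auto simp: bij_betw_def inj_on_image_set_diff[of f "{..<Suc m}"] inj_on_diff)
  then have "bij_betw f {..<m} (I - {f m})"
    by (simp add: lessThan_Suc)
  then have "bij_betw (f(m := m)) {..<m} (I - {f m})"
    by (rule bij_betw_cong[THEN iffD1, rotated]) simp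
  then show "f(m := m) \<in> enumerations m (I - {f m})"
    using f by (auto simp: enumerations_def)
qed

text \<open>
  Laplace expansion along the last row.  Its only nonzero entry is in column \<open>j\<close>, which forms an
  inversion with each column of \<open>I\<close> after \<open>j\<close>.
\<close>

lemma det_submatrix_append_unit_row:
  fixes A :: "'a::comm_ring_1 mat"
  assumes A: "A \<in> carrier_mat m n" and I: "I \<subseteq> {..<n}" "card I = Suc m"
  shows "det (submatrix (append_unit_row A j) UNIV I) =
    (if j \<in> I then (- 1) ^ card {x \<in> I. j < x} * det (submatrix A UNIV (I - {j})) else 0)"
proof -
  define A' where "A' = append_unit_row A j"
  define g where "g f = of_int (inversion_sign (Suc m) f) * (\<Prod>r<Suc m. A' $$ (r, f r))" for f
  have fin: "finite I" using I finite_subset by blast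
  have A': "A' \<in> carrier_mat (Suc m) n" using A by (simp add: A'_def append_unit_row_def)
  have A'_old: "A' $$ (r, c) = A $$ (r, c)" if "r < m" "c < n" for r c
    using that A by (simp add: A'_def append_unit_row_def)
  have A'_new: "A' $$ (m, c) = (if c = j then 1 else 0)" if "c < n" for c
    using that A by (simp add: A'_def append_unit_row_def)
  have range: "f r < n" if "f \<in> enumerations (Suc m) I" "r < Suc m" for f r
  proof -
    have "f r \<in> I"
      using that bij_betwE by (fastforce simp: enumerations_def)
    then show ?thesis using I by auto
  qed
  have det: "det (submatrix A' UNIV I) = (\<Sum>f\<in>enumerations (Suc m) I. g f)"
    unfolding g_def by (rule det_submatrix_columns[OF A' I])
  also have "\<dots> = (\<Sum>f | f \<in> enumerations (Suc m) I \<and> f m = j. g f)"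
    using finite_enumerations[OF fin I(2)]
    by (intro sum.mono_neutral_right) (auto simp: g_def A'_new range)
  finally have det: "det (submatrix A' UNIV I) =
    (\<Sum>f | f \<in> enumerations (Suc m) I \<and> f m = j. g f)" .
  show ?thesis
  proof (cases "j \<in> I")
    case False
    then have none: "{f. f \<in> enumerations (Suc m) I \<and> f m = j} = {}"
      by (auto simp: enumerations_def bij_betw_def)
    show ?thesis using det False unfolding none by (simp add: A'_def)
  next
    case True
    then have I': "I - {j} \<subseteq> {..<n}" "card (I - {j}) = m" using I fin by auto
    have "(\<Sum>f | f \<in> enumerations (Suc m) I \<and> f m = j. g f) =
        (\<Sum>f\<in>enumerations m (I - {j}). g (f(m := j)))"
      by (rule sum.reindex_bij_betw[OF enumerations_Suc[OF fin I(2) True], symmetric])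
    also have "\<dots> = (\<Sum>f\<in>enumerations m (I - {j}). (- 1) ^ card {x \<in> I. j < x} *
        (of_int (inversion_sign m f) * (\<Prod>r<m. A $$ (r, f r))))"
    proof (intro sum.cong refl)
      fix f assume f: "f \<in> enumerations m (I - {j})"
      then have b: "bij_betw f {..<m} (I - {j})" by (simp add: enumerations_def)
      have fr: "f r \<in> I - {j}" if "r < m" for r using b that bij_betwE by fastforce
      have "(\<Prod>r<m. order_sign (f r) j) = (\<Prod>x\<in>I - {j}. order_sign x j)"
        by (rule prod.reindex_bij_betw[OF b])
      also have "\<dots> = (\<Prod>x\<in>I - {j}. if x \<in> {x. j < x} then - 1 else 1)"
        by (intro prod.cong refl) (auto simp: order_sign_def)
      also have "\<dots> = (\<Prod>x\<in>(I - {j}) \<inter> {x. j < x}. - 1)"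
        using fin by (intro prod.inter_restrict[symmetric]) simp
      also have "(I - {j}) \<inter> {x. j < x} = {x \<in> I. j < x}" by auto
      finally have "(\<Prod>r<m. order_sign (f r) j) = (- 1) ^ card {x \<in> I. j < x}" by simp
      then have "inversion_sign (Suc m) (f(m := j)) = inversion_sign m f * (- 1) ^ card {x \<in> I. j < x}"
        by (simp add: inversion_sign_def)
      moreover have "(\<Prod>r<Suc m. A' $$ (r, (f(m := j)) r)) = (\<Prod>r<m. A $$ (r, f r))"
        using I True fr by (auto simp: A'_new A'_old subset_iff intro!: prod.cong)
      ultimately show "g (f(m := j)) = (- 1) ^ card {x \<in> I. j < x} *
          (of_int (inversion_sign m f) * (\<Prod>r<m. A $$ (r, f r)))"
        unfolding g_def by simp
    qed
    also have "\<dots> = (- 1) ^ card {x \<in> I. j < x} * det (submatrix A UNIV (I - {j}))"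
      unfolding det_submatrix_columns[OF A I'] sum_distrib_left ..
    finally show ?thesis using det True by (simp add: A'_def)
  qed
qed

section \<open>Noncrossing triangles\<close>

definition vertices :: "nat \<times> nat \<times> nat \<Rightarrow> nat set" where
  "vertices = (\<lambda>(a, b, c). {a, b, c})"

definition ordered :: "nat \<times> nat \<times> nat \<Rightarrow> bool" where
  "ordered = (\<lambda>(a, b, c). a < b \<and> b < c)"

lemma ordered_triple_unique:
  fixes a b c :: nat
  assumes "{a, b, c} = {a', b', c'}" "a < b" "b < c" "a' < b'" "b' < c'"
  shows "a = a' \<and> b = b' \<and> c = c'"
proof -
  have "[a, b, c] = [a', b', c']"
    using assms by (intro sorted_distinct_set_unique) auto
  then show ?thesis by simp
qed

lemma inj_on_vertices: "inj_on vertices (Collect ordered)"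
proof (rule inj_onI, clarsimp simp: vertices_def ordered_def)
  fix a b c a' b' c' :: nat
  assume "a < b" "b < c" "a' < b'" "b' < c'" "{a, b, c} = {a', b', c'}"
  then show "a = a' \<and> b = b' \<and> c = c'" by (intro ordered_triple_unique)
qed

lemma crossing_sym: "crossing e f \<Longrightarrow> crossing f e"
  unfolding crossing_def by metis

text \<open>
  The two endpoints of a side are neighbours, or the first and the last vertex; in both cases all
  other vertices lie on the same side of it.
\<close>

lemma polygon_side_not_crossing:
  assumes e: "e \<in> polygon_sides n" and f: "f \<subseteq> {..<n}"
  shows "\<not> crossing e f"
proof
  assume "crossing e f"
  then obtain a b c d where ord: "a < b" "b < c" "c < d"
    and ef: "e = {a, c} \<and> f = {b, d} \<or> e = {b, d} \<and> f = {a, c}"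
    unfolding crossing_def by blast
  obtain i where i: "i < n" "e = {i, Suc i mod n}" using e by (auto simp: polygon_sides_def)
  show False
  proof (cases "Suc i < n")
    case True
    then have "e = {i, Suc i}" using i by simp
    then show ?thesis using ef ord by (auto simp: doubleton_eq_iff)
  next
    case False
    then have "Suc i = n" using i by simp
    then have "e = {i, 0}" using i by simp
    then show ?thesis using ef ord f \<open>Suc i = n\<close> by (auto simp: doubleton_eq_iff)
  qed
qed

lemma triangulation_edges_bounded:
  assumes "triangulation n D" "e \<in> D \<union> polygon_sides n"
  shows "e \<subseteq> {..<n}"
proof (cases "e \<in> D")
  case True
  then have "e \<in> diagonals n" using assms(1) by (auto simp: triangulation_def)
  then show ?thesis by (auto simp: diagonals_def)
next
  case False
  then obtain i where "i < n" "e = {i, Suc i mod n}" using assms(2) by (auto simp: polygon_sides_def)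
  then show ?thesis by simp
qed

lemma triangulation_edges_not_crossing:
  assumes T: "triangulation n D" and e: "e \<in> D \<union> polygon_sides n" and f: "f \<in> D \<union> polygon_sides n"
  shows "\<not> crossing e f"
proof (cases "e \<in> D \<and> f \<in> D")
  case True
  then show ?thesis using T by (simp add: triangulation_def)
next
  case False
  then consider "e \<in> polygon_sides n" | "f \<in> polygon_sides n" using e f by blast
  then show ?thesis
  proof cases
    case 1
    then show ?thesis using polygon_side_not_crossing triangulation_edges_bounded[OF T f] by simp
  next
    case 2
    then have "\<not> crossing f e"
      using polygon_side_not_crossing triangulation_edges_bounded[OF T e] by simp
    then show ?thesis using crossing_sym by metis
  qed
qed

lemma edges_not_crossing_order:
  assumes "triangulation n D" "{x, y} \<in> D \<union> polygon_sides n" "{u, v} \<in> D \<union> polygon_sides n"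
  shows "\<not> (x < u \<and> u < y \<and> y < v)"
proof
  assume "x < u \<and> u < y \<and> y < v"
  then have "crossing {x, y} {u, v}"
    unfolding crossing_def by (intro exI[of _ x] exI[of _ u] exI[of _ y] exI[of _ v]) simp
  then show False using triangulation_edges_not_crossing[OF assms] by simp
qed

lemma triangle_edges:
  assumes "{a, b, c} \<in> triangles n D" "a < b" "b < c"
  shows "c < n" "{a, b} \<in> D \<union> polygon_sides n" "{b, c} \<in> D \<union> polygon_sides n"
    "{a, c} \<in> D \<union> polygon_sides n"
proof -
  have "\<exists>a' b' c'. {a, b, c} = {a', b', c'} \<and> a' < b' \<and> b' < c' \<and> c' < n \<and>
      {{a', b'}, {b', c'}, {a', c'}} \<subseteq> D \<union> polygon_sides n"
    using assms(1) by (simp only: triangles_def mem_Collect_eq)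
  then obtain a' b' c' where eq: "{a, b, c} = {a', b', c'}" and ord: "a' < b'" "b' < c'"
    and "c' < n" and edges: "{{a', b'}, {b', c'}, {a', c'}} \<subseteq> D \<union> polygon_sides n"
    by (elim exE conjE)
  moreover have "a' = a" "b' = b" "c' = c"
    using ordered_triple_unique[OF eq assms(2,3) ord] by simp_all
  ultimately show "c < n" "{a, b} \<in> D \<union> polygon_sides n" "{b, c} \<in> D \<union> polygon_sides n"
    "{a, c} \<in> D \<union> polygon_sides n"
    by (simp_all only: insert_subset)
qed

lemma triangle_bounded: "t \<in> triangles n D \<Longrightarrow> t \<subseteq> {..<n}"
  by (auto simp: triangles_def)

text \<open>
  An arc that crosses no side of a triangle lies in one of the three regions that the sides cut off.
  The region behind the long side from \<open>a\<close> to \<open>c\<close> accounts for the last three alternatives: the arc is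
  to the left of the triangle, to the right of it, or passes around it.
\<close>

lemma triangle_arc_position:
  assumes T: "triangulation n D" and t: "{a, b, c} \<in> triangles n D" "a < b" "b < c"
    and ij: "{i, j} \<in> D \<union> polygon_sides n"
  shows "a \<le> i \<and> j \<le> b \<or> b \<le> i \<and> j \<le> c \<or> j \<le> a \<or> c \<le> i \<or> i \<le> a \<and> c \<le> j"
proof -
  note e = triangle_edges[OF t]
  note edges_not_crossing_order[OF T]
  note X = this[OF e(2) ij] this[OF e(3) ij] this[OF e(4) ij]
    this[OF ij e(2)] this[OF ij e(3)] this[OF ij e(4)]
  consider "i \<le> a" | "a < i" "i < b" | "b \<le> i" "i < c" | "c \<le> i" by linarith
  then show ?thesis
  proof cases
    case 1
    show ?thesis
    proof (cases "j \<le> a \<or> c \<le> j")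
      case False
      then have j: "a < j" "j < c" by simp_all
      then have "i = a" using 1 X(6) by (simp add: le_less)
      moreover from this have "j \<le> b" using j X(5) t(2) by (simp add: not_less)
      ultimately show ?thesis by simp
    qed (use 1 in blast)
  next
    case 2
    then have "j \<le> b" using X(1) by (simp add: not_less)
    with 2 show ?thesis by simp
  next
    case 3
    then have "a < i" using t(2) by simp
    then have "j \<le> c" using 3 X(3) by (simp add: not_less)
    with 3 show ?thesis by blast
  next
    case 4
    then show ?thesis by blast
  qed
qed


text \<open>
  The possible relative positions of two triangles that do not cross: the second one is behind the
  side \<open>a b\<close> or \<open>b c\<close> of the first one, the first one is behind such a side of the second one, or one
  of them comes after the other.
\<close>

definition separated :: "nat \<times> nat \<times> nat \<Rightarrow> nat \<times> nat \<times> nat \<Rightarrow> bool" where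
  "separated = (\<lambda>(a, b, c) (a', b', c').
     a \<le> a' \<and> c' \<le> b \<or> b \<le> a' \<and> c' \<le> c \<or> a' \<le> a \<and> c \<le> b' \<or> b' \<le> a \<and> c \<le> c' \<or> c \<le> a' \<or> c' \<le> a)"

text \<open>
  The position of the long side of the second triangle relative to the first one decides, unless it
  passes around the first triangle; then the position of the other two sides decides.
\<close>

lemma triangles_separated:
  assumes T: "triangulation n D"
    and t: "vertices t \<in> triangles n D" "ordered t"
    and t': "vertices t' \<in> triangles n D" "ordered t'"
    and neq: "t \<noteq> t'"
  shows "separated t t'"
proof -
  obtain a b c where t_eq: "t = (a, b, c)" by (cases t)
  obtain a' b' c' where t'_eq: "t' = (a', b', c')" by (cases t')
  have ord: "a < b" "b < c" "a' < b'" "b' < c'"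
    using t(2) t'(2) by (auto simp: t_eq t'_eq ordered_def)
  have "{a, b, c} \<in> triangles n D" "{a', b', c'} \<in> triangles n D"
    using t(1) t'(1) by (auto simp: t_eq t'_eq vertices_def)
  note pos = triangle_arc_position[OF T this(1) ord(1,2)]
    and e = triangle_edges[OF this(2) ord(3,4)]
  have neq: "a \<noteq> a' \<or> b \<noteq> b' \<or> c \<noteq> c'" using neq by (simp add: t_eq t'_eq)
  have "a \<le> a' \<and> c' \<le> b \<or> b \<le> a' \<and> c' \<le> c \<or> a' \<le> a \<and> c \<le> b' \<or> b' \<le> a \<and> c \<le> c' \<or> c \<le> a' \<or> c' \<le> a"
  proof (cases "a' \<le> a \<and> c \<le> c'")
    case True
    show ?thesis
      using pos[OF e(2)] pos[OF e(3)] by (elim disjE conjE) (use True ord neq in linarith)+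
  next
    case False
    then show ?thesis using pos[OF e(4)] by blast
  qed
  then show ?thesis by (simp add: separated_def t_eq t'_eq)
qed

text \<open>
  The second triangle is to the left of the side of the first one that is opposite to \<open>v\<close>.  Entry
  \<open>v\<close> of a row of the twistor coordinate matrix is, up to sign, the twistor coordinate of this side, so
  its sign is determined by the number of black triangles in this position.
\<close>

definition beneath :: "nat \<times> nat \<times> nat \<Rightarrow> nat \<times> nat \<times> nat \<Rightarrow> nat \<Rightarrow> bool" where
  "beneath = (\<lambda>(a, b, c) (a', b', c') v.
     v = a \<and> b \<le> a' \<and> c' \<le> c \<or> v = b \<and> a \<le> a' \<and> c' \<le> c \<or> v = c \<and> a \<le> a' \<and> c' \<le> b)"

definition neg_if :: "bool \<Rightarrow> int" where
  "neg_if P = (if P then - 1 else 1)"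

lemma prod_neg_if:
  "finite S \<Longrightarrow> (\<Prod>s\<in>S. neg_if (P s)) = (- 1) ^ card {s \<in> S. P s}"
  unfolding neg_if_def by (subst prod.inter_filter[symmetric]) (auto)

text \<open>
  The value that is shown in \<open>separated_pair_sign\<close> to be the contribution of a pair of triangles to
  the sign of a matching: \<open>1\<close> if \<open>t'\<close> is behind the first side \<open>a b\<close> of \<open>t\<close>, or \<open>t\<close> is behind the
  second side of \<open>t'\<close>, or \<open>t\<close> precedes \<open>t'\<close>, and \<open>- 1\<close> in the three mirrored positions.
\<close>

definition pair_sign :: "nat \<times> nat \<times> nat \<Rightarrow> nat \<times> nat \<times> nat \<Rightarrow> int" where
  "pair_sign = (\<lambda>(a, b, c) (a', b', c').
     if a \<le> a' \<and> c' \<le> b \<or> b' \<le> a \<and> c \<le> c' \<or> c \<le> a' then 1 else - 1)"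

text \<open>
  This independence of \<open>v\<close> and \<open>v'\<close> is the reason why the twistor coordinate matrix has minors of
  one sign.  Suppose for instance that \<open>t'\<close> is behind the side \<open>a b\<close> of \<open>t\<close>.  Then \<open>t\<close> is beneath no side
  of \<open>t'\<close>.  For \<open>v = a\<close> the vertex \<open>v'\<close> comes after \<open>v\<close>, and \<open>t'\<close> is not to the left of the opposite side;
  for \<open>v = b\<close> and \<open>v = c\<close> it comes before \<open>v\<close>, and \<open>t'\<close> is to the left of the opposite side.  So two signs
  cancel or there are none.  The other positions are similar.
\<close>

lemma separated_pair_sign:
  assumes "separated t t'" "ordered t" "ordered t'"
    and "v \<in> vertices t" "v' \<in> vertices t'" "v \<noteq> v'"
  shows "order_sign v v' * neg_if (beneath t t' v) * neg_if (beneath t' t v') = pair_sign t t'"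
proof -
  obtain a b c where t: "t = (a, b, c)" by (cases t)
  obtain a' b' c' where t': "t' = (a', b', c')" by (cases t')
  have ord: "a < b" "b < c" "a' < b'" "b' < c'"
    using assms(2,3) by (auto simp: t t' ordered_def)
  have v: "v = a \<or> v = b \<or> v = c" "v' = a' \<or> v' = b' \<or> v' = c'"
    using assms(4,5) by (auto simp: t t' vertices_def)
  have sep: "a \<le> a' \<and> c' \<le> b \<or> b \<le> a' \<and> c' \<le> c \<or> a' \<le> a \<and> c \<le> b' \<or> b' \<le> a \<and> c \<le> c' \<or> c \<le> a' \<or> c' \<le> a"
    using assms(1) by (simp add: separated_def t t')
  note v' = v(2) and v = v(1)
  have distinct: "a \<noteq> b" "a \<noteq> c" "b \<noteq> c" "a' \<noteq> b'" "a' \<noteq> c'" "b' \<noteq> c'" using ord by auto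
  have neq: "v < v' \<or> v' < v" using assms(6) by linarith
  note unf = t t' order_sign_def neg_if_def beneath_def pair_sign_def prod.case
  consider "a \<le> a'" "c' \<le> b" | "b \<le> a'" "c' \<le> c" | "a' \<le> a" "c \<le> b'" | "b' \<le> a" "c \<le> c'"
    | "c \<le> a'" | "c' \<le> a"
    using sep by blast
  then show ?thesis
  proof cases
    case 1
    have "(a \<le> a' \<and> c' \<le> b) = True" "(b \<le> a' \<and> c' \<le> c) = False" "(a \<le> a' \<and> c' \<le> c) = True"
      "(a' \<le> a \<and> c \<le> b') = False" "(b' \<le> a \<and> c \<le> c') = False" "(a' \<le> a \<and> c \<le> c') = False"
      "(c \<le> a') = False" by (simp_all only: eq_True eq_False) (use 1 ord in linarith)+
    note n = this
    have "(v < v') = (v = a)" using v v' neq 1 ord by (elim disjE) linarith+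
    then show ?thesis unfolding unf n using v v' distinct by (elim disjE) simp_all
  next
    case 2
    have "(a \<le> a' \<and> c' \<le> b) = False" "(b \<le> a' \<and> c' \<le> c) = True" "(a \<le> a' \<and> c' \<le> c) = True"
      "(a' \<le> a \<and> c \<le> b') = False" "(b' \<le> a \<and> c \<le> c') = False" "(a' \<le> a \<and> c \<le> c') = False"
      "(c \<le> a') = False" by (simp_all only: eq_True eq_False) (use 2 ord in linarith)+
    note n = this
    have "(v < v') = (v \<noteq> c)" using v v' neq 2 ord by (elim disjE) linarith+
    then show ?thesis unfolding unf n using v v' distinct by (elim disjE) simp_all
  next
    case 3
    have "(a \<le> a' \<and> c' \<le> b) = False" "(b \<le> a' \<and> c' \<le> c) = False" "(a \<le> a' \<and> c' \<le> c) = False"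
      "(a' \<le> a \<and> c \<le> b') = True" "(b' \<le> a \<and> c \<le> c') = False" "(a' \<le> a \<and> c \<le> c') = True"
      "(c \<le> a') = False" by (simp_all only: eq_True eq_False) (use 3 ord in linarith)+
    note n = this
    have "(v < v') = (v' \<noteq> a')" using v v' neq 3 ord by (elim disjE) linarith+
    then show ?thesis unfolding unf n using v v' distinct by (elim disjE) simp_all
  next
    case 4
    have "(a \<le> a' \<and> c' \<le> b) = False" "(b \<le> a' \<and> c' \<le> c) = False" "(a \<le> a' \<and> c' \<le> c) = False"
      "(a' \<le> a \<and> c \<le> b') = False" "(b' \<le> a \<and> c \<le> c') = True" "(a' \<le> a \<and> c \<le> c') = True"
      "(c \<le> a') = False" by (simp_all only: eq_True eq_False) (use 4 ord in linarith)+
    note n = this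
    have "(v < v') = (v' = c')" using v v' neq 4 ord by (elim disjE) linarith+
    then show ?thesis unfolding unf n using v v' distinct by (elim disjE) simp_all
  next
    case 5
    have "(a \<le> a' \<and> c' \<le> b) = False" "(b \<le> a' \<and> c' \<le> c) = False" "(a \<le> a' \<and> c' \<le> c) = False"
      "(a' \<le> a \<and> c \<le> b') = False" "(b' \<le> a \<and> c \<le> c') = False" "(a' \<le> a \<and> c \<le> c') = False"
      "(c \<le> a') = True" by (simp_all only: eq_True eq_False) (use 5 ord in linarith)+
    note n = this
    have "v < v'" using v v' neq 5 ord by (elim disjE) linarith+
    then show ?thesis unfolding unf n by simp
  next
    case 6
    have "(a \<le> a' \<and> c' \<le> b) = False" "(b \<le> a' \<and> c' \<le> c) = False" "(a \<le> a' \<and> c' \<le> c) = False"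
      "(a' \<le> a \<and> c \<le> b') = False" "(b' \<le> a \<and> c \<le> c') = False" "(a' \<le> a \<and> c \<le> c') = False"
      "(c \<le> a') = False" by (simp_all only: eq_True eq_False) (use 6 ord in linarith)+
    note n = this
    have "\<not> v < v'" using v v' neq 6 ord by (elim disjE) linarith+
    then show ?thesis unfolding unf n by simp
  qed
qed

text \<open>
  Each unordered pair of indices occurs twice on the left, once in each order.
\<close>

lemma prod_off_diagonal:
  fixes x :: "nat \<Rightarrow> nat \<Rightarrow> 'a::comm_monoid_mult"
  shows "(\<Prod>r<k. \<Prod>s\<in>{..<k} - {r}. x r s) = (\<Prod>s<k. \<Prod>r<s. x r s * x s r)"
proof (induction k)
  case (Suc k)
  have "(\<Prod>r<Suc k. \<Prod>s\<in>{..<Suc k} - {r}. x r s)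
      = (\<Prod>r<k. \<Prod>s\<in>{..<Suc k} - {r}. x r s) * (\<Prod>s<k. x k s)"
    by (simp add: lessThan_Suc mult.commute)
  also have "(\<Prod>r<k. \<Prod>s\<in>{..<Suc k} - {r}. x r s) = (\<Prod>r<k. x r k * (\<Prod>s\<in>{..<k} - {r}. x r s))"
    by (intro prod.cong refl) (auto simp: lessThan_Suc insert_Diff_if)
  finally show ?case by (simp add: prod.distrib Suc mult_ac)
qed simp

lemma matching_sign_constant:
  assumes sep: "\<And>r s. r < k \<Longrightarrow> s < k \<Longrightarrow> r \<noteq> s \<Longrightarrow> separated (t r) (t s)"
    and ord: "\<And>r. r < k \<Longrightarrow> ordered (t r)"
    and f: "inj_on f {..<k}" "\<And>r. r < k \<Longrightarrow> f r \<in> vertices (t r)"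
  shows "inversion_sign k f * (\<Prod>r<k. \<Prod>s\<in>{..<k} - {r}. neg_if (beneath (t r) (t s) (f r))) =
    (\<Prod>s<k. \<Prod>r<s. pair_sign (t r) (t s))"
proof -
  have "inversion_sign k f * (\<Prod>r<k. \<Prod>s\<in>{..<k} - {r}. neg_if (beneath (t r) (t s) (f r))) =
    (\<Prod>s<k. \<Prod>r<s. order_sign (f r) (f s) *
      (neg_if (beneath (t r) (t s) (f r)) * neg_if (beneath (t s) (t r) (f s))))"
    unfolding inversion_sign_def prod_off_diagonal by (simp add: prod.distrib)
  also have "\<dots> = (\<Prod>s<k. \<Prod>r<s. pair_sign (t r) (t s))"
  proof (intro prod.cong refl)
    fix s r assume "s \<in> {..<k}" "r \<in> {..<s}"
    then have "r < k" "s < k" "r \<noteq> s" by auto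
    moreover from this have "f r \<noteq> f s" using inj_onD[OF f(1)] by auto
    ultimately show "order_sign (f r) (f s) *
      (neg_if (beneath (t r) (t s) (f r)) * neg_if (beneath (t s) (t r) (f s))) = pair_sign (t r) (t s)"
      using separated_pair_sign[of "t r" "t s" "f r" "f s"] sep ord f(2) by (simp add: mult.assoc)
  qed
  finally show ?thesis .
qed

definition beside :: "nat \<Rightarrow> nat \<Rightarrow> nat \<times> nat \<times> nat \<Rightarrow> bool" where
  "beside i j = (\<lambda>(a, b, c). a \<le> i \<and> j \<le> b \<or> b \<le> i \<and> j \<le> c \<or> j \<le> a \<or> c \<le> i \<or> i \<le> a \<and> c \<le> j)"

text \<open>
  For an arc from \<open>i\<close> to \<open>j\<close> behind one of the sides of the triangle, this is the vertex opposite to that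
  side: the one that points away from the arc.
\<close>

definition apex :: "nat \<Rightarrow> nat \<Rightarrow> nat \<times> nat \<times> nat \<Rightarrow> nat" where
  "apex i j = (\<lambda>(a, b, c). if a \<le> i \<and> j \<le> b then c else if b \<le> i \<and> j \<le> c then a else b)"

lemma apex_in_vertices: "apex i j t \<in> vertices t"
  by (auto simp: apex_def vertices_def split: prod.split)

lemma apex_cases:
  fixes a b c :: nat
  assumes "a < b" "b < c" "i < j" and ij: "beside i j (a, b, c)"
  obtains "a \<le> i" "j \<le> b" "apex i j (a, b, c) = c" | "b \<le> i" "j \<le> c" "apex i j (a, b, c) = a"
    | "j \<le> a" "apex i j (a, b, c) = b" | "c \<le> i" "apex i j (a, b, c) = b"
    | "i \<le> a" "c \<le> j" "apex i j (a, b, c) = b"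
proof -
  consider "a \<le> i" "j \<le> b" | "b \<le> i" "j \<le> c" | "j \<le> a" | "c \<le> i" | "i \<le> a" "c \<le> j"
    using ij by (auto simp: beside_def)
  then show thesis
  proof cases
    case 1
    then show ?thesis using that(1) by (simp add: apex_def)
  next
    case 2
    then have "\<not> (a \<le> i \<and> j \<le> b)" using assms(1-3) by linarith
    then show ?thesis using that(2) 2 unfolding apex_def prod.case by (simp only: if_False if_True simp_thms)
  next
    case 3
    then have "\<not> (a \<le> i \<and> j \<le> b)" "\<not> (b \<le> i \<and> j \<le> c)" using assms(1-3) by linarith+
    then show ?thesis using that(3) 3 unfolding apex_def prod.case by (simp only: if_False)
  next
    case 4
    then have "\<not> (a \<le> i \<and> j \<le> b)" "\<not> (b \<le> i \<and> j \<le> c)" using assms(1-3) by linarith+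
    then show ?thesis using that(4) 4 unfolding apex_def prod.case by (simp only: if_False)
  next
    case 5
    then have "\<not> (a \<le> i \<and> j \<le> b)" "\<not> (b \<le> i \<and> j \<le> c)" using assms(1-3) by linarith+
    then show ?thesis using that(5) 5 unfolding apex_def prod.case by (simp only: if_False)
  qed
qed

lemma apex_not_on_arc:
  assumes "beside i j t" "ordered t" "i < j"
  shows "apex i j t \<noteq> i" "apex i j t \<noteq> j"
proof -
  obtain a b c where t: "t = (a, b, c)" by (cases t)
  have ord: "a < b" "b < c" using assms by (auto simp: t ordered_def)
  show "apex i j t \<noteq> i" "apex i j t \<noteq> j" unfolding t
    by (rule apex_cases[OF ord assms(3) assms(1)[unfolded t]]; use ord assms(3) in linarith)+
qed

text \<open>
  When noncrossing triangles are glued on one after the other, starting at the arc, the apex of a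
  triangle is the one vertex that is added with it, so no vertex is the apex of two triangles.
  Formally this is a finite check of positions.
\<close>

lemma apex_distinct:
  assumes sep: "separated t t'" and ord: "ordered t" "ordered t'"
    and ij: "beside i j t" "beside i j t'" "i < j"
  shows "apex i j t \<noteq> apex i j t'"
proof
  obtain a b c where t: "t = (a, b, c)" by (cases t)
  obtain a' b' c' where t': "t' = (a', b', c')" by (cases t')
  have ord: "a < b" "b < c" "a' < b'" "b' < c'" "i < j"
    using ord ij(3) by (auto simp: t t' ordered_def)
  have sep: "a \<le> a' \<and> c' \<le> b \<or> b \<le> a' \<and> c' \<le> c \<or> a' \<le> a \<and> c \<le> b' \<or> b' \<le> a \<and> c \<le> c' \<or> c \<le> a' \<or> c' \<le> a"
    using sep by (simp add: separated_def t t')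
  assume "apex i j t = apex i j t'"
  then have eq: "apex i j (a, b, c) = apex i j (a', b', c')" by (simp add: t t')
  show False
    by (rule apex_cases[OF ord(1,2,5) ij(1)[unfolded t]]; rule apex_cases[OF ord(3,4,5) ij(2)[unfolded t']];
      insert sep; elim disjE conjE; insert eq ord; linarith)
qed

section \<open>Black triangles and their matchings\<close>

locale bicolored =
  fixes k n :: nat and D B :: "nat set set"
  assumes bicolored: "bicolored_triangulation k n D B"
begin

text \<open>
  The triangle that belongs to row \<open>r\<close> of the twistor coordinate matrix.
\<close>

definition tri :: "nat \<Rightarrow> nat \<times> nat \<times> nat" where
  "tri r = triangle_list n B ! r"

lemma triangulation: "triangulation n D"
  and black_triangles: "B \<subseteq> triangles n D"
  and card_B: "card B = k"
  using bicolored by (auto simp: bicolored_triangulation_def)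

lemma bij_betw_vertices_triangle_list: "bij_betw vertices (set (triangle_list n B)) B"
proof -
  have "inj_on vertices (set (triangle_list n B))"
    by (rule inj_on_subset[OF inj_on_vertices]) (auto simp: set_triangle_list ordered_def)
  moreover have "vertices ` set (triangle_list n B) = B"
  proof (intro equalityI subsetI)
    fix t assume "t \<in> B"
    then have "t \<in> triangles n D" using black_triangles by blast
    then obtain a b c where "t = {a, b, c}" "a < b" "b < c" "c < n" by (auto simp: triangles_def)
    then have "(a, b, c) \<in> set (triangle_list n B)" "t = vertices (a, b, c)"
      using \<open>t \<in> B\<close> by (auto simp: set_triangle_list vertices_def)
    then show "t \<in> vertices ` set (triangle_list n B)" by blast
  qed (auto simp: set_triangle_list vertices_def)
  ultimately show ?thesis by (simp add: bij_betw_def)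
qed

lemma distinct_triangle_list: "distinct (triangle_list n B)"
proof -
  have "sorted_wrt (\<lambda>s t. s \<noteq> t) (triangle_list n B)"
    by (rule sorted_wrt_mono_rel[OF _ sorted_triangle_list]) auto
  from sorted_wrt_nth_less[OF this] show ?thesis
    unfolding distinct_conv_nth by (metis linorder_neqE_nat)
qed

lemma length_triangle_list: "length (triangle_list n B) = k"
  using bij_betw_same_card[OF bij_betw_vertices_triangle_list] distinct_card[OF distinct_triangle_list]
    card_B by simp

lemma bij_betw_tri: "bij_betw (\<lambda>r. vertices (tri r)) {..<k} B"
proof -
  have "bij_betw tri {..<k} (set (triangle_list n B))"
    unfolding tri_def length_triangle_list[symmetric]
    by (rule bij_betw_nth[OF distinct_triangle_list]) auto
  from bij_betw_trans[OF this bij_betw_vertices_triangle_list] show ?thesis by (simp add: o_def)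
qed

lemma tri_black: "r < k \<Longrightarrow> vertices (tri r) \<in> B"
  using bij_betw_tri by (auto simp: bij_betw_def)

lemma tri_triangle: "r < k \<Longrightarrow> vertices (tri r) \<in> triangles n D"
  using tri_black black_triangles by blast

lemma tri_ordered:
  assumes "r < k"
  shows "ordered (tri r)"
proof -
  have "tri r \<in> set (triangle_list n B)"
    unfolding tri_def using assms by (intro nth_mem) (simp add: length_triangle_list)
  then show ?thesis by (auto simp: set_triangle_list ordered_def)
qed

lemma tri_separated:
  assumes "r < k" "s < k" "r \<noteq> s"
  shows "separated (tri r) (tri s)"
proof -
  have "tri r \<noteq> tri s"
    unfolding tri_def using assms
    by (simp add: nth_eq_iff_index_eq[OF distinct_triangle_list] length_triangle_list)
  then show ?thesis
    using triangles_separated[OF triangulation] tri_triangle tri_ordered assms by blast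
qed

lemma black_arc_edge:
  assumes "black_arc B i j"
  shows "{i, j} \<in> D \<union> polygon_sides n"
proof -
  obtain t where t: "t \<in> B" "i \<in> t" "j \<in> t" and "i \<noteq> j"
    using assms by (auto simp: black_arc_def)
  then have "t \<in> triangles n D" using black_triangles by blast
  then have "\<exists>a b c. t = {a, b, c} \<and> {{a, b}, {b, c}, {a, c}} \<subseteq> D \<union> polygon_sides n"
    unfolding triangles_def by (elim CollectE exE conjE) (intro exI conjI)
  then obtain a b c where abc: "t = {a, b, c}"
      "{a, b} \<in> D \<union> polygon_sides n" "{b, c} \<in> D \<union> polygon_sides n" "{a, c} \<in> D \<union> polygon_sides n"
    by (simp only: insert_subset) (elim exE conjE)
  have "{i, j} = {a, b} \<or> {i, j} = {b, c} \<or> {i, j} = {a, c}"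
    using t abc(1) \<open>i \<noteq> j\<close> by auto
  then show ?thesis using abc(2-4) by (elim disjE) simp_all
qed

lemma black_arc_bounded:
  assumes "black_arc B i j"
  shows "i < n" "j < n"
  using triangulation_edges_bounded[OF triangulation black_arc_edge[OF assms]] by auto

lemma tri_beside:
  assumes "r < k" "black_arc B i j"
  shows "beside i j (tri r)"
proof -
  obtain a b c where t: "tri r = (a, b, c)" by (cases "tri r")
  then have "a < b" "b < c" "{a, b, c} \<in> triangles n D"
    using tri_ordered[OF assms(1)] tri_triangle[OF assms(1)] by (auto simp: ordered_def vertices_def)
  then show ?thesis
    using triangle_arc_position[OF triangulation _ _ _ black_arc_edge[OF assms(2)]]
    by (simp add: t beside_def)
qed

lemma black_arc_tri:
  assumes "r < k" "tri r = (a, b, c)"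
  shows "black_arc B a b" "black_arc B b c" "black_arc B a c" "a < b" "b < c" "a < c" "c < n"
proof -
  have v: "{a, b, c} \<in> B" using tri_black[OF assms(1)] by (simp add: assms(2) vertices_def)
  show ord: "a < b" "b < c" "a < c" using tri_ordered[OF assms(1)] by (auto simp: assms(2) ordered_def)
  show "black_arc B a b" "black_arc B b c" "black_arc B a c"
    using v ord unfolding black_arc_def by (auto intro!: bexI[OF _ v])
  then show "c < n" using black_arc_bounded by blast
qed

lemma area_eq:
  assumes "i < j"
  shows "area n B i j = card {r. r < k \<and> vertices (tri r) \<subseteq> {i..j}}"
proof -
  have "bij_betw (\<lambda>r. vertices (tri r)) {r. r < k \<and> vertices (tri r) \<subseteq> {i..j}} {t \<in> B. t \<subseteq> {i..j}}"
  proof (rule bij_betw_subset[OF bij_betw_tri])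
    show "(\<lambda>r. vertices (tri r)) ` {r. r < k \<and> vertices (tri r) \<subseteq> {i..j}} = {t \<in> B. t \<subseteq> {i..j}}"
    proof (intro equalityI subsetI)
      fix t assume t: "t \<in> {t \<in> B. t \<subseteq> {i..j}}"
      then obtain r where "r < k" "t = vertices (tri r)" using bij_betw_tri unfolding bij_betw_def by blast
      then show "t \<in> (\<lambda>r. vertices (tri r)) ` {r. r < k \<and> vertices (tri r) \<subseteq> {i..j}}"
        using t by blast
    qed (use tri_black in blast)
  qed auto
  from bij_betw_same_card[OF this] show ?thesis using assms by (simp add: area_def left_vertices_def)
qed

lemma vertices_within:
  assumes "s < k" "tri s = (a', b', c')"
  shows "vertices (tri s) \<subseteq> {i..j} \<longleftrightarrow> i \<le> a' \<and> c' \<le> j"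
  using tri_ordered[OF assms(1)] by (auto simp: assms(2) ordered_def vertices_def)

text \<open>
  The three areas that determine the signs of a row.  The triangle of row \<open>r\<close> is itself counted in
  the area of its long side from \<open>a\<close> to \<open>c\<close>, but it is not in the product; this accounts for the minus
  sign in the middle, which is that of the middle entry of the row.
\<close>

lemma prod_beneath:
  assumes r: "r < k" "tri r = (a, b, c)"
  shows "(\<Prod>s\<in>{..<k} - {r}. neg_if (beneath (tri r) (tri s) a)) = (- 1) ^ area n B b c"
    and "(\<Prod>s\<in>{..<k} - {r}. neg_if (beneath (tri r) (tri s) b)) = - ((- 1) ^ area n B a c)"
    and "(\<Prod>s\<in>{..<k} - {r}. neg_if (beneath (tri r) (tri s) c)) = (- 1) ^ area n B a b"
proof -
  note ord = black_arc_tri(4-6)[OF r]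
  have within: "vertices (tri s) \<subseteq> {i..j} \<longleftrightarrow> (case tri s of (a', b', c') \<Rightarrow> i \<le> a' \<and> c' \<le> j)"
    if "s < k" for s i j
    using vertices_within[OF that] by (cases "tri s") simp
  have a: "beneath (a, b, c) t a \<longleftrightarrow> (case t of (a', b', c') \<Rightarrow> b \<le> a' \<and> c' \<le> c)"
    and b: "beneath (a, b, c) t b \<longleftrightarrow> (case t of (a', b', c') \<Rightarrow> a \<le> a' \<and> c' \<le> c)"
    and c: "beneath (a, b, c) t c \<longleftrightarrow> (case t of (a', b', c') \<Rightarrow> a \<le> a' \<and> c' \<le> b)" for t
    using ord by (cases t; simp add: beneath_def r)+
  define W where "W s x y \<longleftrightarrow> vertices (tri s) \<subseteq> {x..y}" for s x y
  have a: "beneath (tri r) (tri s) a \<longleftrightarrow> W s b c"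
    and b: "beneath (tri r) (tri s) b \<longleftrightarrow> W s a c"
    and c: "beneath (tri r) (tri s) c \<longleftrightarrow> W s a b" if "s < k" for s
    unfolding W_def within[OF that] r(2) a b c by (rule refl)+
  have "\<not> W r b c" "W r a c" "\<not> W r a b"
    using ord by (simp_all add: W_def r(2) vertices_def)
  then have "{s \<in> {..<k} - {r}. beneath (tri r) (tri s) a} = {s. s < k \<and> W s b c}"
      "{s \<in> {..<k} - {r}. beneath (tri r) (tri s) c} = {s. s < k \<and> W s a b}"
      "{s. s < k \<and> W s a c} = insert r {s \<in> {..<k} - {r}. beneath (tri r) (tri s) b}"
    using a b c r(1) by auto
  note sets = this[unfolded W_def]
  show "(\<Prod>s\<in>{..<k} - {r}. neg_if (beneath (tri r) (tri s) a)) = (- 1) ^ area n B b c"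
    using sets(1) by (simp add: prod_neg_if area_eq[OF ord(2)])
  show "(\<Prod>s\<in>{..<k} - {r}. neg_if (beneath (tri r) (tri s) c)) = (- 1) ^ area n B a b"
    using sets(2) by (simp add: prod_neg_if area_eq[OF ord(1)])
  have "area n B a c = Suc (card {s \<in> {..<k} - {r}. beneath (tri r) (tri s) b})"
    unfolding area_eq[OF ord(3)] sets(3) by (subst card_insert_disjoint) auto
  then show "(\<Prod>s\<in>{..<k} - {r}. neg_if (beneath (tri r) (tri s) b)) = - ((- 1) ^ area n B a c)"
    by (simp add: prod_neg_if)
qed

lemma black_matchings_iff:
  assumes I: "I \<subseteq> {..<n}"
  shows "I \<in> black_matchings n B \<longleftrightarrow> (\<exists>f\<in>enumerations k I. \<forall>r<k. f r \<in> vertices (tri r))"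
proof
  assume "I \<in> black_matchings n B"
  then obtain \<phi> where \<phi>: "bij_betw \<phi> I B" "\<And>i. i \<in> I \<Longrightarrow> i \<in> \<phi> i" by (auto simp: black_matchings_def)
  define e where "e = the_inv_into I \<phi>"
  have e: "bij_betw e B I" unfolding e_def by (rule bij_betw_the_inv_into[OF \<phi>(1)])
  have \<phi>_e: "\<phi> (e t) = t" if "t \<in> B" for t
    unfolding e_def using \<phi>(1) that by (intro f_the_inv_into_f) (auto simp: bij_betw_def)
  define f where "f r = (if r < k then e (vertices (tri r)) else r)" for r
  have "bij_betw f {..<k} I"
    using bij_betw_trans[OF bij_betw_tri e]
    by (rule bij_betw_cong[THEN iffD1, rotated]) (simp add: f_def)
  then have "f \<in> enumerations k I" by (simp add: enumerations_def f_def)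
  moreover have "f r \<in> vertices (tri r)" if "r < k" for r
  proof -
    have "e (vertices (tri r)) \<in> \<phi> (e (vertices (tri r)))"
      using \<phi>(2) bij_betwE[OF e] tri_black[OF that] by blast
    then show ?thesis using \<phi>_e tri_black[OF that] that by (simp add: f_def)
  qed
  ultimately show "\<exists>f\<in>enumerations k I. \<forall>r<k. f r \<in> vertices (tri r)" by blast
next
  assume "\<exists>f\<in>enumerations k I. \<forall>r<k. f r \<in> vertices (tri r)"
  then obtain f where f: "bij_betw f {..<k} I" "\<And>r. r < k \<Longrightarrow> f r \<in> vertices (tri r)"
    by (auto simp: enumerations_def)
  define e where "e = the_inv_into {..<k} f"
  have e: "bij_betw e I {..<k}" unfolding e_def by (rule bij_betw_the_inv_into[OF f(1)])
  have f_e: "f (e i) = i" if "i \<in> I" for i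
    unfolding e_def using f(1) that by (intro f_the_inv_into_f) (auto simp: bij_betw_def)
  have "bij_betw ((\<lambda>r. vertices (tri r)) \<circ> e) I B"
    using e bij_betw_tri by (rule bij_betw_trans)
  moreover have "i \<in> vertices (tri (e i))" if "i \<in> I" for i
    using f(2)[of "e i"] f_e[OF that] bij_betwE[OF e] that by auto
  ultimately show "I \<in> black_matchings n B"
    using I unfolding black_matchings_def by (auto intro!: exI[of _ "(\<lambda>r. vertices (tri r)) \<circ> e"])
qed

lemma black_matchings_card:
  assumes "I \<in> black_matchings n B"
  shows "I \<subseteq> {..<n}" "card I = k"
  using assms card_B by (auto simp: black_matchings_def dest: bij_betw_same_card)

text \<open>
  The apices of the black triangles are distinct and different from the endpoints of the arc.
\<close>

lemma matching_avoiding_arc: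
  assumes arc: "black_arc B i j" and "i < j"
  obtains I where "I \<in> black_matchings n B" "i \<notin> I" "j \<notin> I"
proof
  define f where "f r = (if r < k then apex i j (tri r) else r)" for r
  define I where "I = f ` {..<k}"
  have "inj_on f {..<k}"
  proof (rule inj_onI, rule ccontr)
    fix r s assume rs: "r \<in> {..<k}" "s \<in> {..<k}" "f r = f s" "r \<noteq> s"
    then have "apex i j (tri r) \<noteq> apex i j (tri s)"
      using arc \<open>i < j\<close> by (intro apex_distinct tri_separated tri_ordered tri_beside) auto
    with rs show False by (simp add: f_def)
  qed
  then have "f \<in> enumerations k I"
    by (simp add: enumerations_def I_def bij_betw_def f_def)
  moreover have f: "f r \<in> vertices (tri r)" if "r < k" for r
    using that apex_in_vertices by (simp add: f_def)
  moreover have "I \<subseteq> {..<n}"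
    using f tri_triangle triangle_bounded by (fastforce simp: I_def)
  ultimately show "I \<in> black_matchings n B" using black_matchings_iff by blast
  have "x \<in> I \<Longrightarrow> \<exists>r<k. x = apex i j (tri r)" for x by (auto simp: I_def f_def)
  then show "i \<notin> I" "j \<notin> I"
    using apex_not_on_arc[OF tri_beside[OF _ arc] tri_ordered \<open>i < j\<close>] by metis+
qed

text \<open>
  A triangle on the left of the arc has all its vertices in \<open>{i..j}\<close>, a triangle on the right has none
  strictly between \<open>i\<close> and \<open>j\<close>.  When \<open>i\<close> and \<open>j\<close> are not used, the vertices strictly between them are
  exactly those that are matched with the triangles on the left.
\<close>

lemma matching_parity:
  assumes I: "I \<in> black_matchings n B" and arc: "black_arc B i j" "i < j" and ij: "i \<notin> I" "j \<notin> I"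
  shows "card {x \<in> I. i < x \<and> x < j} = area n B i j"
proof -
  obtain f where f: "bij_betw f {..<k} I" and f_in: "\<And>r. r < k \<Longrightarrow> f r \<in> vertices (tri r)"
    using I black_matchings_iff[OF black_matchings_card(1)[OF I]] by (auto simp: enumerations_def)
  have "i < f r \<and> f r < j \<longleftrightarrow> vertices (tri r) \<subseteq> {i..j}" if r: "r < k" for r
  proof -
    obtain a b c where t: "tri r = (a, b, c)" by (cases "tri r")
    note ord = black_arc_tri(4,5)[OF r t]
    have v: "f r = a \<or> f r = b \<or> f r = c" using f_in[OF r] by (simp add: t vertices_def)
    have "f r \<in> I" using f r by (auto simp: bij_betw_def)
    then have ne: "f r < i \<or> i < f r" "f r < j \<or> j < f r" using ij by (metis linorder_neqE_nat)+
    have "a \<le> i \<and> j \<le> b \<or> b \<le> i \<and> j \<le> c \<or> j \<le> a \<or> c \<le> i \<or> i \<le> a \<and> c \<le> j"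
      using tri_beside[OF r arc(1)] by (simp add: beside_def t)
    then have "i < f r \<and> f r < j \<longleftrightarrow> i \<le> a \<and> c \<le> j"
    proof (elim disjE conjE)
      assume "i \<le> a" "c \<le> j"
      moreover from this have "i < f r \<and> f r < j"
        using v ord ne by (elim disjE) linarith+
      ultimately show ?thesis by simp
    next
      assume h: "a \<le> i" "j \<le> b"
      have "\<not> (i < f r \<and> f r < j)" using v by (elim disjE) (use h ord arc(2) in linarith)+
      moreover have "\<not> (i \<le> a \<and> c \<le> j)" using h ord by linarith
      ultimately show ?thesis by blast
    next
      assume h: "b \<le> i" "j \<le> c"
      have "\<not> (i < f r \<and> f r < j)" using v by (elim disjE) (use h ord arc(2) in linarith)+
      moreover have "\<not> (i \<le> a \<and> c \<le> j)" using h ord by linarith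
      ultimately show ?thesis by blast
    next
      assume h: "j \<le> a"
      have "\<not> (i < f r \<and> f r < j)" using v by (elim disjE) (use h ord arc(2) in linarith)+
      moreover have "\<not> (i \<le> a \<and> c \<le> j)" using h ord by linarith
      ultimately show ?thesis by blast
    next
      assume h: "c \<le> i"
      have "\<not> (i < f r \<and> f r < j)" using v by (elim disjE) (use h ord arc(2) in linarith)+
      moreover have "\<not> (i \<le> a \<and> c \<le> j)" using h ord arc(2) by linarith
      ultimately show ?thesis by blast
    qed
    then show ?thesis using vertices_within[OF r t] by simp
  qed
  then have "{r. r < k \<and> vertices (tri r) \<subseteq> {i..j}} = {r \<in> {..<k}. i < f r \<and> f r < j}" by auto
  moreover have "bij_betw f {r \<in> {..<k}. i < f r \<and> f r < j} {x \<in> I. i < x \<and> x < j}"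
    using f by (auto simp: bij_betw_def inj_on_def)
  then have "card {r \<in> {..<k}. i < f r \<and> f r < j} = card {x \<in> I. i < x \<and> x < j}"
    by (rule bij_betw_same_card)
  ultimately show ?thesis by (simp only: area_eq[OF arc(2)])
qed

definition total_sign :: int where
  "total_sign = (\<Prod>s<k. \<Prod>r<s. pair_sign (tri r) (tri s))"

lemma total_sign_cases: "total_sign = 1 \<or> total_sign = - 1"
proof -
  have "\<bar>total_sign\<bar> = 1"
    unfolding total_sign_def abs_prod by (intro prod.neutral ballI) (simp add: pair_sign_def split: prod.split)
  then show ?thesis by linarith
qed

text \<open>
  Only matchings contribute to the expansion of a minor, and by \<open>matching_sign_constant\<close> they all
  contribute with the same sign, so nothing cancels.  The factor \<open>\<sigma>\<close> is there for representatives whose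
  twistor coordinates satisfy the sign conditions after multiplication by a common negative number.
\<close>

lemma kasteleyn_plucker:
  fixes C :: "real mat"
  assumes C: "C \<in> carrier_mat k n"
    and zero: "\<And>r v. r < k \<Longrightarrow> v < n \<Longrightarrow> v \<notin> vertices (tri r) \<Longrightarrow> C $$ (r, v) = 0"
    and sgn: "\<And>r v. r < k \<Longrightarrow> v \<in> vertices (tri r) \<Longrightarrow>
      sgn (C $$ (r, v)) = \<sigma> * of_int (\<Prod>s\<in>{..<k} - {r}. neg_if (beneath (tri r) (tri s) v))"
    and \<sigma>: "\<sigma> = 1 \<or> \<sigma> = - 1"
    and I: "I \<subseteq> {..<n}" "card I = k"
  shows "sgn (plucker C I) =
    (if I \<in> black_matchings n B then \<sigma> ^ k * of_int total_sign else 0)"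
proof -
  define \<epsilon> :: real where "\<epsilon> = \<sigma> ^ k * of_int total_sign"
  define g where "g f = of_int (inversion_sign k f) * (\<Prod>r<k. C $$ (r, f r))" for f
  have \<epsilon>: "\<epsilon> = 1 \<or> \<epsilon> = - 1"
  proof -
    have "\<sigma> ^ k = 1 \<or> \<sigma> ^ k = - 1" using \<sigma> by (cases "even k") auto
    then show ?thesis using total_sign_cases unfolding \<epsilon>_def by auto
  qed
  have fin: "finite I" using I finite_subset by blast
  have range: "f r < n" if "f \<in> enumerations k I" "r < k" for f r
  proof -
    have "bij_betw f {..<k} I" using that by (simp add: enumerations_def)
    then have "f r \<in> I" using that(2) by (auto simp: bij_betw_def)
    then show ?thesis using I(1) by blast
  qed
  have sgn_prod: "sgn (\<Prod>r<m. h r) = (\<Prod>r<m. sgn (h r))" for m and h :: "nat \<Rightarrow> real"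
    by (induction m) (simp_all add: sgn_mult)
  have sgn_g: "sgn (g f) = \<epsilon>" if f: "f \<in> enumerations k I" and match: "\<forall>r<k. f r \<in> vertices (tri r)" for f
  proof -
    have inj: "inj_on f {..<k}" using f by (simp add: enumerations_def bij_betw_def)
    have "\<bar>inversion_sign k f\<bar> = 1"
      unfolding inversion_sign_def abs_prod by (intro prod.neutral ballI) (simp add: order_sign_def)
    then have sgn_inv: "sgn (real_of_int (inversion_sign k f)) = of_int (inversion_sign k f)" by (auto simp: abs_if split: if_splits)
    have "sgn (\<Prod>r<k. C $$ (r, f r)) = (\<Prod>r<k. sgn (C $$ (r, f r)))"
      by (rule sgn_prod)
    also have "\<dots> = (\<Prod>r<k. \<sigma> * of_int (\<Prod>s\<in>{..<k} - {r}. neg_if (beneath (tri r) (tri s) (f r))))"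
      using match by (intro prod.cong refl sgn) auto
    also have "\<dots> = \<sigma> ^ k * of_int (\<Prod>r<k. \<Prod>s\<in>{..<k} - {r}. neg_if (beneath (tri r) (tri s) (f r)))"
      by (simp only: prod.distrib prod_constant card_lessThan of_int_prod)
    finally have "sgn (g f) = \<sigma> ^ k * of_int (inversion_sign k f *
        (\<Prod>r<k. \<Prod>s\<in>{..<k} - {r}. neg_if (beneath (tri r) (tri s) (f r))))"
      unfolding g_def sgn_mult sgn_inv by simp
    also have "inversion_sign k f * (\<Prod>r<k. \<Prod>s\<in>{..<k} - {r}. neg_if (beneath (tri r) (tri s) (f r))) = total_sign"
      unfolding total_sign_def
      by (rule matching_sign_constant[OF tri_separated tri_ordered inj]) (use match in auto)
    finally show ?thesis by (simp add: \<epsilon>_def)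
  qed
  have g_0: "g f = 0" if f: "f \<in> enumerations k I" and match: "\<not> (\<forall>r<k. f r \<in> vertices (tri r))" for f
  proof -
    obtain r where "r < k" "f r \<notin> vertices (tri r)" using match by blast
    then have "C $$ (r, f r) = 0" using zero range[OF f] by blast
    then show ?thesis unfolding g_def using \<open>r < k\<close> by auto
  qed
  have plucker: "plucker C I = (\<Sum>f\<in>enumerations k I. g f)"
    unfolding plucker_def g_def by (rule det_submatrix_columns[OF C I])
  show ?thesis
  proof (cases "I \<in> black_matchings n B")
    case False
    then have "plucker C I = 0"
      unfolding plucker using black_matchings_iff[OF I(1)] g_0 by (intro sum.neutral) blast
    then show ?thesis using False by simp
  next
    case True
    then obtain f0 where f0: "f0 \<in> enumerations k I" "\<forall>r<k. f0 r \<in> vertices (tri r)"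
      using black_matchings_iff[OF I(1)] by blast
    have "0 < (\<Sum>f\<in>enumerations k I. \<epsilon> * g f)"
    proof (rule sum_pos2[OF finite_enumerations[OF fin I(2)] f0(1)])
      show "0 < \<epsilon> * g f0" using sgn_g[OF f0] \<epsilon> by (auto simp: sgn_if split: if_splits)
      show "0 \<le> \<epsilon> * g f" if "f \<in> enumerations k I" for f
        using sgn_g[OF that] g_0[OF that] \<epsilon> by (fastforce simp: sgn_if split: if_splits)
    qed
    then have "0 < \<epsilon> * plucker C I" unfolding plucker sum_distrib_left .
    then have "sgn (plucker C I) = \<epsilon>" using \<epsilon> by (auto simp: sgn_if)
    then show ?thesis using True by (simp add: \<epsilon>_def)
  qed
qed

end

section \<open>Row spaces and twistor coordinates\<close>

lemma row_space_image:
  assumes "A \<in> carrier_mat k q"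
  shows "vec_space.row_space q (A :: real mat) = (\<lambda>y. A\<^sup>T *\<^sub>v y) ` carrier_vec k"
  unfolding vec_space.row_space_eq[OF assms] carrier_matD[OF assms]
  using mult_mat_vec_carrier[OF transpose_carrier_mat[THEN iffD2, OF assms]] by blast

lemma row_space_mult_subset:
  fixes A H :: "real mat"
  assumes A: "A \<in> carrier_mat k q" and H: "H \<in> carrier_mat l k"
  shows "vec_space.row_space q (H * A) \<subseteq> vec_space.row_space q A"
proof
  fix w assume "w \<in> vec_space.row_space q (H * A)"
  then obtain y where y: "y \<in> carrier_vec l" "w = (H * A)\<^sup>T *\<^sub>v y"
    unfolding row_space_image[OF mult_carrier_mat[OF H A]] by blast
  have "w = A\<^sup>T *\<^sub>v (H\<^sup>T *\<^sub>v y)"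
    unfolding y(2) transpose_mult[OF H A] using A H y(1) by (intro assoc_mult_mat_vec) auto
  moreover have "H\<^sup>T *\<^sub>v y \<in> carrier_vec k" using H y(1) by auto
  ultimately show "w \<in> vec_space.row_space q A" unfolding row_space_image[OF A] by blast
qed

lemma det_nonzero_inverse:
  fixes H :: "'a::field mat"
  assumes "H \<in> carrier_mat k k" "det H \<noteq> 0"
  obtains H' where "H' \<in> carrier_mat k k" "H * H' = 1\<^sub>m k" "H' * H = 1\<^sub>m k"
  using det_non_zero_imp_unit[OF assms, of "()"] by (auto simp: Units_def ring_mat_simps)

lemma row_space_mult_invertible:
  fixes A H :: "real mat"
  assumes A: "A \<in> carrier_mat k q" and H: "H \<in> carrier_mat k k" and "det H \<noteq> 0"
  shows "vec_space.row_space q (H * A) = vec_space.row_space q A"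
proof
  obtain H' where H': "H' \<in> carrier_mat k k" "H' * H = 1\<^sub>m k"
    using det_nonzero_inverse[OF H assms(3)] by blast
  have "H' * (H * A) = A"
    using assoc_mult_mat[OF H'(1) H A] by (simp add: H'(2) left_mult_one_mat[OF A])
  then show "vec_space.row_space q A \<subseteq> vec_space.row_space q (H * A)"
    using row_space_mult_subset[OF mult_carrier_mat[OF H A] H'(1)] by simp
qed (rule row_space_mult_subset[OF A H])

text \<open>
  Containment of row spaces as a matrix factorization, which lets determinants detect equality of
  the row spaces.
\<close>

lemma rows_in_row_space_factor:
  fixes A B :: "real mat"
  assumes A: "A \<in> carrier_mat k q" and B: "B \<in> carrier_mat l q"
    and rows: "\<And>i. i < l \<Longrightarrow> row B i \<in> vec_space.row_space q A"
  obtains G where "G \<in> carrier_mat l k" "B = G * A"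
proof -
  have "\<forall>i<l. \<exists>y. y \<in> carrier_vec k \<and> row B i = A\<^sup>T *\<^sub>v y"
    using rows unfolding row_space_image[OF A] by blast
  then obtain y where y: "\<And>i. i < l \<Longrightarrow> y i \<in> carrier_vec k" "\<And>i. i < l \<Longrightarrow> row B i = A\<^sup>T *\<^sub>v y i"
    by metis
  define G where "G = mat l k (\<lambda>(i, j). y i $ j)"
  have G: "G \<in> carrier_mat l k" by (simp add: G_def)
  have "B = G * A"
  proof (rule eq_matI)
    fix i j assume "i < dim_row (G * A)" "j < dim_col (G * A)"
    then have ij: "i < l" "j < q" using A by (auto simp: G_def)
    have row_G: "row G i = y i" using y(1)[OF ij(1)] ij(1) by (intro eq_vecI) (auto simp: G_def)
    have "B $$ (i, j) = row B i $ j" using ij B by simp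
    also have "\<dots> = col A j \<bullet> y i" using ij A by (simp add: y(2))
    also have "\<dots> = y i \<bullet> col A j"
      using y(1)[OF ij(1)] A ij by (intro comm_scalar_prod[of _ k]) auto
    also have "\<dots> = (G * A) $$ (i, j)" using ij A by (simp add: G_def row_G[unfolded G_def])
    finally show "B $$ (i, j) = (G * A) $$ (i, j)" .
  qed (use A B in \<open>auto simp: G_def\<close>)
  with G that show thesis by blast
qed

lemma row_in_row_space:
  fixes A :: "real mat"
  assumes A: "A \<in> carrier_mat k q" and i: "i < k"
  shows "row A i \<in> vec_space.row_space q A"
proof -
  interpret vec_space "TYPE(real)" q .
  have "set (rows A) \<subseteq> carrier_vec q" using A rows_carrier[of A] by simp
  moreover have "row A i \<in> set (rows A)" using A i by (auto simp: rows_def)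
  ultimately show ?thesis unfolding row_space_def using in_own_span by auto
qed

lemma row_space_in_Gr_iff_rank:
  fixes A :: "real mat"
  assumes A: "A \<in> carrier_mat k q"
  shows "vec_space.row_space q A \<in> Gr k q \<longleftrightarrow> vec_space.rank q A\<^sup>T = k"
proof -
  interpret vec_space "TYPE(real)" q .
  have "set (rows A) \<subseteq> carrier V" using A rows_carrier[of A] by simp
  then have "VectorSpace.subspace class_ring (span (set (rows A))) V" using span_is_subspace by simp
  then show ?thesis
    unfolding Gr_def row_space_def rank_def cols_transpose by simp
qed

lemma plucker_nonzero_in_Gr:
  assumes A: "A \<in> carrier_mat k q" and I: "I \<subseteq> {..<q}" "card I = k" and nz: "plucker A I \<noteq> 0"
  shows "vec_space.row_space q A \<in> Gr k q"
proof -
  interpret vec_space "TYPE(real)" q .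
  have "submatrix A\<^sup>T I UNIV = (submatrix A UNIV I)\<^sup>T"
    unfolding submatrix_columns_eq[OF A I(1)] submatrix_rows_eq[OF transpose_carrier_mat[THEN iffD2, OF A] I(1)]
    using A pick_bounded[OF I(1)] by (intro eq_matI) auto
  moreover have "submatrix A UNIV I \<in> carrier_mat k k"
    unfolding submatrix_columns_eq[OF A I(1)] by (simp add: I(2))
  ultimately have "det (submatrix A\<^sup>T I UNIV) \<noteq> 0"
    using nz by (simp add: plucker_def det_transpose)
  then have "card {j. j < k \<and> j \<in> UNIV} \<le> rank A\<^sup>T"
    using A by (intro rank_gt_minor[of _ _ I]) auto
  moreover have "rank A\<^sup>T \<le> k" using A by (intro rank_le_nc) auto
  ultimately show ?thesis using row_space_in_Gr_iff_rank[OF A] by simp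
qed

text \<open>
  The matrix whose determinant is a twistor coordinate, with arbitrary vectors in place of rows of
  \<open>Z\<close>.
\<close>

definition border :: "real mat \<Rightarrow> real vec \<Rightarrow> real vec \<Rightarrow> real mat" where
  "border A u v = mat (dim_row A + 2) (dim_col A)
     (\<lambda>(r, c). if r < dim_row A then A $$ (r, c) else if r = dim_row A then u $ c else v $ c)"

lemma border_carrier: "A \<in> carrier_mat k q \<Longrightarrow> border A u v \<in> carrier_mat (k + 2) q"
  by (simp add: border_def)

lemma twistor_eq_det_border:
  assumes "A \<in> carrier_mat k q" "dim_col Z = q"
  shows "twistor Z A i j = det (border A (row Z i) (row Z j))"
proof -
  have "mat_of_rows (dim_col Z) (rows A @ [row Z i, row Z j]) = border A (row Z i) (row Z j)"
    using assms
    by (intro eq_matI) (auto simp: border_def mat_of_rows_def nth_append less_Suc_eq nth_Cons' numeral_2_eq_2)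
  then show ?thesis by (simp add: twistor_def)
qed

text \<open>
  A nonzero twistor coordinate makes all rows of the bordered matrix independent, in particular those
  of \<open>A\<close>.
\<close>

lemma border_nonzero_in_Gr:
  assumes A: "A \<in> carrier_mat k (k + 2)" and u: "u \<in> carrier_vec (k + 2)" "v \<in> carrier_vec (k + 2)"
    and nz: "det (border A u v) \<noteq> 0"
  shows "vec_space.row_space (k + 2) A \<in> Gr k (k + 2)"
proof -
  interpret vec_space "TYPE(real)" "k + 2" .
  define M where "M = (border A u v)\<^sup>T"
  have M: "M \<in> carrier_mat (k + 2) (k + 2)" using border_carrier[OF A] by (simp add: M_def)
  have "det M \<noteq> 0" using nz det_transpose[OF border_carrier[OF A]] by (simp add: M_def)
  then have rank: "rank M = k + 2" by (rule low_rank_det_zero[OF M])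
  then have distinct: "distinct (cols M)" using non_distinct_low_rank[OF M] by (metis less_irrefl)
  have indpt: "lin_indpt (set (cols M))" by (rule full_rank_lin_indpt[OF M rank distinct])
  have "cols A\<^sup>T = take k (cols M)"
  proof (rule nth_equalityI)
    fix i assume "i < length (cols A\<^sup>T)"
    then have i: "i < k" using A by simp
    have "row A i = row (border A u v) i"
      using A i by (intro eq_vecI) (auto simp: border_def)
    then show "cols A\<^sup>T ! i = take k (cols M) ! i"
      using A M i border_carrier[OF A, of u v] by (simp add: M_def)
  qed (use A M in simp)
  then have "set (cols A\<^sup>T) \<subseteq> set (cols M)" "distinct (cols A\<^sup>T)"
    using set_take_subset distinct by (metis, simp)
  moreover have "A\<^sup>T \<in> carrier_mat (k + 2) k" using A by simp
  ultimately have "rank A\<^sup>T = k"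
    using subset_li_is_li[OF indpt] by (intro lin_indpt_full_rank)
  then show ?thesis using row_space_in_Gr_iff_rank[OF A] by simp
qed

text \<open>
  The bordered matrix of \<open>H * A\<close> arises from that of \<open>A\<close> by multiplication with a block diagonal
  matrix with blocks \<open>H\<close> and the identity.
\<close>

lemma det_border_mult:
  assumes A: "A \<in> carrier_mat k (k + 2)" and H: "H \<in> carrier_mat k k"
  shows "det (border (H * A) u v) = det H * det (border A u v)"
proof -
  define E where "E = four_block_mat H (0\<^sub>m k 2) (0\<^sub>m 2 k) (1\<^sub>m 2)"
  have E: "E \<in> carrier_mat (k + 2) (k + 2)" unfolding E_def using H by auto
  have M: "border A u v \<in> carrier_mat (k + 2) (k + 2)" by (rule border_carrier[OF A])
  have sum: "(\<Sum>l = 0..<k + 2. g l) = (\<Sum>l = 0..<k. g l) + g k + g (Suc k)" for g :: "nat \<Rightarrow> real"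
    by (simp add: numeral_2_eq_2)
  have "border (H * A) u v = E * border A u v"
  proof (rule eq_matI)
    fix r c assume "r < dim_row (E * border A u v)" "c < dim_col (E * border A u v)"
    then have rc: "r < k + 2" "c < k + 2" using E M by auto
    have "(E * border A u v) $$ (r, c) = (\<Sum>l = 0..<k + 2. E $$ (r, l) * border A u v $$ (l, c))"
      using E M rc by (auto simp: scalar_prod_def)
    also have "\<dots> = border (H * A) u v $$ (r, c)"
    proof -
      consider "r < k" | "r = k" | "r = Suc k" using rc by linarith
      then show ?thesis
      proof cases
        case 1
        then show ?thesis using A H rc unfolding sum
          by (auto simp: E_def border_def scalar_prod_def intro!: sum.cong)
      next
        case 2
        then show ?thesis using A H rc unfolding sum
          by (simp add: E_def border_def)
      next
        case 3
        then show ?thesis using A H rc unfolding sum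
          by (simp add: E_def border_def)
      qed
    qed
    finally show "border (H * A) u v $$ (r, c) = (E * border A u v) $$ (r, c)" ..
  qed (use A H E in \<open>auto simp: border_def\<close>)
  moreover have "det E = det H"
    unfolding E_def using H by (subst det_four_block_mat_upper_right_zero[of _ k _ 2]) auto
  ultimately show ?thesis using det_mult[OF E M] by simp
qed

lemma plucker_mult:
  assumes A: "A \<in> carrier_mat k q" and H: "H \<in> carrier_mat k k" and I: "I \<subseteq> {..<q}" "card I = k"
  shows "plucker (H * A) I = det H * plucker A I"
proof -
  have "submatrix (H * A) UNIV I = H * submatrix A UNIV I"
    unfolding submatrix_columns_eq[OF A I(1)] submatrix_columns_eq[OF mult_carrier_mat[OF H A] I(1)]
    using A H I(2) pick_bounded[OF I(1)] by (intro eq_matI) (auto simp: scalar_prod_def)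
  then show ?thesis
    unfolding plucker_def using H by (simp add: det_mult[of _ k] submatrix_columns_eq[OF A I(1)] I(2))
qed

text \<open>
  Expand \<open>u\<close> in the basis formed by the rows of \<open>A\<close>, \<open>v\<close> and \<open>w\<close>.  By Cramer's rule the coefficients
  of \<open>v\<close> and \<open>w\<close> are the quotients of the determinants of \<open>A\<close> bordered by \<open>u, w\<close> and by \<open>v, u\<close> and of \<open>A\<close>
  bordered by \<open>v, w\<close>; what remains of \<open>u\<close> is in the row space of \<open>A\<close>.
\<close>

lemma three_term_in_row_space:
  assumes A: "A \<in> carrier_mat k (k + 2)"
    and uvw: "u \<in> carrier_vec (k + 2)" "v \<in> carrier_vec (k + 2)" "w \<in> carrier_vec (k + 2)"
    and nz: "det (border A v w) \<noteq> 0"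
  shows "det (border A v w) \<cdot>\<^sub>v u - det (border A u w) \<cdot>\<^sub>v v + det (border A u v) \<cdot>\<^sub>v w
    \<in> vec_space.row_space (k + 2) A"
proof -
  define d where "d = det (border A v w)"
  define N where "N = (border A v w)\<^sup>T"
  have N: "N \<in> carrier_mat (k + 2) (k + 2)" using border_carrier[OF A] by (simp add: N_def)
  have det_N: "det N = d" unfolding N_def d_def by (rule det_transpose[OF border_carrier[OF A]])
  obtain N' where N': "N' \<in> carrier_mat (k + 2) (k + 2)" "N * N' = 1\<^sub>m (k + 2)"
    using det_nonzero_inverse[OF N] nz det_N d_def by metis
  define x where "x = N' *\<^sub>v u"
  have x: "x \<in> carrier_vec (k + 2)" using N' uvw by (simp add: x_def)
  have Nx: "N *\<^sub>v x = u"
    unfolding x_def using assoc_mult_mat_vec[OF N N'(1) uvw(1)] uvw by (simp add: N'(2))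
  have "replace_col N u k = (border A u w)\<^sup>T"
    using A N by (intro eq_matI) (auto simp: replace_col_def N_def border_def)
  then have uw: "det (border A u w) = x $ k * d"
    using cramer_lemma_mat[OF N x, of k] det_transpose[OF border_carrier[OF A]] by (simp add: Nx det_N)
  have "replace_col N u (Suc k) = (border A v u)\<^sup>T"
    using A N by (intro eq_matI) (auto simp: replace_col_def N_def border_def)
  then have vu: "det (border A v u) = x $ Suc k * d"
    using cramer_lemma_mat[OF N x, of "Suc k"] det_transpose[OF border_carrier[OF A]] by (simp add: Nx det_N)
  have "border A v u = swaprows k (Suc k) (border A u v)"
    using A by (intro eq_matI) (auto simp: mat_swaprows_def border_def)
  then have uv: "det (border A u v) = - (x $ Suc k * d)"
    using det_swaprows[OF _ _ _ border_carrier[OF A], of k "Suc k" u v] vu by simp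
  \<comment> \<open>the coordinates of the vector in question in terms of the rows of \<open>A\<close>\<close>
  define y where "y = vec k (\<lambda>l. d * x $ l)"
  have "d \<cdot>\<^sub>v u - det (border A u w) \<cdot>\<^sub>v v + det (border A u v) \<cdot>\<^sub>v w = A\<^sup>T *\<^sub>v y"
  proof (rule eq_vecI)
    fix c assume "c < dim_vec (A\<^sup>T *\<^sub>v y)"
    then have c: "c < k + 2" using A by simp
    have "u $ c = (\<Sum>l = 0..<k + 2. N $$ (c, l) * x $ l)"
      using Nx[symmetric] N x c by (auto simp: scalar_prod_def)
    also have "\<dots> = (\<Sum>l = 0..<k. N $$ (c, l) * x $ l) + N $$ (c, k) * x $ k + N $$ (c, Suc k) * x $ Suc k"
      by (simp add: numeral_2_eq_2)
    also have "(\<Sum>l = 0..<k. N $$ (c, l) * x $ l) = (\<Sum>l = 0..<k. A $$ (l, c) * x $ l)"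
      using A c by (intro sum.cong) (auto simp: N_def border_def)
    finally have "u $ c = (\<Sum>l = 0..<k. A $$ (l, c) * x $ l) + N $$ (c, k) * x $ k + N $$ (c, Suc k) * x $ Suc k" .
    moreover have "N $$ (c, k) = v $ c" "N $$ (c, Suc k) = w $ c"
      using A c by (auto simp: N_def border_def)
    ultimately have u_c: "u $ c = (\<Sum>l = 0..<k. A $$ (l, c) * x $ l) + v $ c * x $ k + w $ c * x $ Suc k" by simp
    have "(A\<^sup>T *\<^sub>v y) $ c = (\<Sum>l = 0..<k. A $$ (l, c) * (d * x $ l))"
      using A c by (auto simp: scalar_prod_def y_def)
    also have "\<dots> = d * (\<Sum>l = 0..<k. A $$ (l, c) * x $ l)"
      by (simp add: sum_distrib_left mult_ac)
    finally show "(d \<cdot>\<^sub>v u - det (border A u w) \<cdot>\<^sub>v v + det (border A u v) \<cdot>\<^sub>v w) $ c = (A\<^sup>T *\<^sub>v y) $ c"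
      using uvw c by (simp add: uw uv u_c algebra_simps)
  qed (use A uvw in auto)
  moreover have "y \<in> carrier_vec k" by (simp add: y_def)
  ultimately show ?thesis unfolding d_def row_space_image[OF A] by blast
qed

text \<open>
  Cauchy--Binet for \<open>C\<close> extended by two unit rows.  The two Laplace expansions give the number of
  elements of \<open>J\<close> after \<open>j\<close> and the number of elements other than \<open>j\<close> after \<open>i\<close>; together they have the
  parity of the number of elements strictly between \<open>i\<close> and \<open>j\<close>.
\<close>

lemma twistor_product_expansion:
  assumes C: "C \<in> carrier_mat k n" and Z: "Z \<in> carrier_mat n (k + 2)" and ij: "i < j" "j < n"
  shows "twistor Z (C * Z) i j =
    (\<Sum>J | J \<subseteq> {..<n} \<and> card J = k + 2. if i \<in> J \<and> j \<in> J
      then (- 1) ^ card {x \<in> J. i < x \<and> x < j} * plucker C (J - {i, j}) * det (submatrix Z J UNIV) else 0)"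
proof -
  define C' where "C' = append_unit_row (append_unit_row C i) j"
  have C1: "append_unit_row C i \<in> carrier_mat (Suc k) n"
    using C by (simp add: append_unit_row_def)
  have C': "C' \<in> carrier_mat (k + 2) n" using C by (simp add: C'_def append_unit_row_def)
  have "border (C * Z) (row Z i) (row Z j) = C' * Z"
  proof (rule eq_matI)
    fix r c assume "r < dim_row (C' * Z)" "c < dim_col (C' * Z)"
    then have rc: "r < k + 2" "c < k + 2" using C' Z by auto
    have entry: "(C' * Z) $$ (r, c) = (\<Sum>l = 0..<n. C' $$ (r, l) * Z $$ (l, c))"
      using C' Z rc by (auto simp: scalar_prod_def)
    have unit: "(\<Sum>l = 0..<n. (if l = p then 1 else 0) * Z $$ (l, c)) = Z $$ (p, c)" if "p < n" for p
      using that by (simp add: if_distrib[where f = "\<lambda>x. x * _"] cong: if_cong)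
    consider "r < k" | "r = k" | "r = Suc k" using rc by linarith
    then show "border (C * Z) (row Z i) (row Z j) $$ (r, c) = (C' * Z) $$ (r, c)"
    proof cases
      case 1
      then have "(\<Sum>l = 0..<n. C' $$ (r, l) * Z $$ (l, c)) = (\<Sum>l = 0..<n. C $$ (r, l) * Z $$ (l, c))"
        using C by (intro sum.cong refl) (simp add: C'_def append_unit_row_def)
      then show ?thesis unfolding entry using 1 rc C Z by (simp add: border_def scalar_prod_def)
    next
      case 2
      then have "(\<Sum>l = 0..<n. C' $$ (r, l) * Z $$ (l, c)) = (\<Sum>l = 0..<n. (if l = i then 1 else 0) * Z $$ (l, c))"
        using C by (intro sum.cong refl) (simp add: C'_def append_unit_row_def)
      then show ?thesis unfolding entry using 2 rc C Z ij unit[of i] by (simp add: border_def)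
    next
      case 3
      then have "(\<Sum>l = 0..<n. C' $$ (r, l) * Z $$ (l, c)) = (\<Sum>l = 0..<n. (if l = j then 1 else 0) * Z $$ (l, c))"
        using C by (intro sum.cong refl) (simp add: C'_def append_unit_row_def)
      then show ?thesis unfolding entry using 3 rc C Z ij unit[of j] by (simp add: border_def)
    qed
  qed (use C C' Z in \<open>auto simp: border_def\<close>)
  then have "twistor Z (C * Z) i j = det (C' * Z)"
    using twistor_eq_det_border[of "C * Z" k "k + 2" Z] C Z by simp
  also have "\<dots> = (\<Sum>J | J \<subseteq> {..<n} \<and> card J = k + 2. det (submatrix C' UNIV J) * det (submatrix Z J UNIV))"
    by (rule Cauchy_Binet[OF C' Z])
  also have "\<dots> = (\<Sum>J | J \<subseteq> {..<n} \<and> card J = k + 2. if i \<in> J \<and> j \<in> J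
      then (- 1) ^ card {x \<in> J. i < x \<and> x < j} * plucker C (J - {i, j}) * det (submatrix Z J UNIV) else 0)"
  proof (intro sum.cong refl)
    fix J assume "J \<in> {J. J \<subseteq> {..<n} \<and> card J = k + 2}"
    then have J: "J \<subseteq> {..<n}" "card J = Suc (Suc k)" by auto
    have fin: "finite J" using J finite_subset by blast
    have last: "det (submatrix C' UNIV J) = (if j \<in> J
        then (- 1) ^ card {x \<in> J. j < x} * det (submatrix (append_unit_row C i) UNIV (J - {j})) else 0)"
      unfolding C'_def by (rule det_submatrix_append_unit_row[OF C1 J])
    show "det (submatrix C' UNIV J) * det (submatrix Z J UNIV) = (if i \<in> J \<and> j \<in> J
      then (- 1) ^ card {x \<in> J. i < x \<and> x < j} * plucker C (J - {i, j}) * det (submatrix Z J UNIV) else 0)"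
    proof (cases "j \<in> J")
      case True
      then have J': "J - {j} \<subseteq> {..<n}" "card (J - {j}) = Suc k" using J fin by auto
      have "{x \<in> J - {j}. i < x} = {x \<in> J. i < x \<and> x < j} \<union> {x \<in> J. j < x}"
        using ij(1) by auto
      then have "card {x \<in> J - {j}. i < x} = card {x \<in> J. i < x \<and> x < j} + card {x \<in> J. j < x}"
        using fin by (simp add: card_Un_disjoint disjoint_iff)
      then have "(- 1 :: real) ^ card {x \<in> J. j < x} * (- 1) ^ card {x \<in> J - {j}. i < x} =
          (- 1) ^ card {x \<in> J. i < x \<and> x < j}"
        by (simp add: power_add flip: power_mult_distrib)
      moreover have "J - {j} - {i} = J - {i, j}" by auto
      ultimately show ?thesis
        unfolding last det_submatrix_append_unit_row[OF C J'] using True ij(1)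
        by (simp add: plucker_def flip: mult.assoc)
    qed (simp add: last)
  qed
  finally show ?thesis .
qed

context bicolored
begin

text \<open>
  By \<open>matching_parity\<close> all nonzero terms of the expansion have the sign given by the area, and
  \<open>matching_avoiding_arc\<close> provides a nonzero term.
\<close>

lemma twistor_sign_of_cell:
  assumes C: "C \<in> carrier_mat k n" and Z: "Z \<in> Mat_pos n (k + 2)"
    and cell: "\<And>I. I \<subseteq> {..<n} \<Longrightarrow> card I = k \<Longrightarrow>
      (I \<in> black_matchings n B \<longrightarrow> plucker C I > 0) \<and> (I \<notin> black_matchings n B \<longrightarrow> plucker C I = 0)"
    and arc: "black_arc B i j" "i < j"
  shows "sgn (twistor Z (C * Z) i j) = (- 1) ^ area n B i j"
proof -
  have Zc: "Z \<in> carrier_mat n (k + 2)"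
    and Zpos: "\<And>J. J \<subseteq> {..<n} \<Longrightarrow> card J = k + 2 \<Longrightarrow> det (submatrix Z J UNIV) > 0"
    using Z by (auto simp: Mat_pos_def)
  note bound = black_arc_bounded[OF arc(1)]
  define \<J> where "\<J> = {J. J \<subseteq> {..<n} \<and> card J = k + 2}"
  define g where "g J = (if i \<in> J \<and> j \<in> J
      then (- 1) ^ card {x \<in> J. i < x \<and> x < j} * plucker C (J - {i, j}) * det (submatrix Z J UNIV) else 0)" for J
  define h where "h J = (if i \<in> J \<and> j \<in> J then plucker C (J - {i, j}) * det (submatrix Z J UNIV) else 0)" for J
  have minus: "J - {i, j} \<subseteq> {..<n}" "card (J - {i, j}) = k" if "J \<in> \<J>" "i \<in> J" "j \<in> J" for J
  proof -
    have "finite J" using that finite_subset by (auto simp: \<J>_def)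
    then show "card (J - {i, j}) = k" using that arc(2) by (subst card_Diff_subset) (auto simp: \<J>_def)
  qed (use that in \<open>auto simp: \<J>_def\<close>)
  have plucker_nonneg: "plucker C I \<ge> 0" if "I \<subseteq> {..<n}" "card I = k" for I
    using cell[OF that] by force
  have g_eq: "g J = (- 1) ^ area n B i j * h J" if J: "J \<in> \<J>" for J
  proof (cases "i \<in> J \<and> j \<in> J \<and> J - {i, j} \<in> black_matchings n B")
    case True
    have "{x \<in> J - {i, j}. i < x \<and> x < j} = {x \<in> J. i < x \<and> x < j}" by auto
    then have "card {x \<in> J. i < x \<and> x < j} = area n B i j"
      using matching_parity[OF _ arc, of "J - {i, j}"] True by simp
    then show ?thesis using True by (simp add: g_def h_def)
  next
    case False
    then have "i \<in> J \<and> j \<in> J \<Longrightarrow> plucker C (J - {i, j}) = 0" using cell minus[OF J] by blast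
    then show ?thesis by (auto simp: g_def h_def)
  qed
  have h_nonneg: "h J \<ge> 0" if "J \<in> \<J>" for J
    using that plucker_nonneg minus[OF that] Zpos[of J] by (auto simp: h_def \<J>_def less_imp_le)
  obtain I where I: "I \<in> black_matchings n B" "i \<notin> I" "j \<notin> I"
    using matching_avoiding_arc[OF arc] by blast
  note I' = black_matchings_card[OF I(1)]
  have "finite I" using I'(1) finite_subset by blast
  then have J: "insert i (insert j I) \<in> \<J>"
    using I I' bound arc(2) by (auto simp: \<J>_def)
  have "insert i (insert j I) - {i, j} = I" using I by auto
  then have "h (insert i (insert j I)) > 0"
    using J cell[OF I'] I(1) Zpos by (simp add: h_def \<J>_def)
  moreover have "finite \<J>" unfolding \<J>_def by simp
  ultimately have pos: "0 < (\<Sum>J\<in>\<J>. h J)"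
    using J h_nonneg by (intro sum_pos2)
  have "twistor Z (C * Z) i j = (\<Sum>J\<in>\<J>. g J)"
    unfolding g_def \<J>_def by (rule twistor_product_expansion[OF C Zc arc(2) bound(2)])
  also have "\<dots> = (- 1) ^ area n B i j * (\<Sum>J\<in>\<J>. h J)"
    unfolding sum_distrib_left by (intro sum.cong refl g_eq)
  finally have "twistor Z (C * Z) i j = (- 1) ^ area n B i j * (\<Sum>J\<in>\<J>. h J)" .
  then show ?thesis using pos by (cases "even (area n B i j)") simp_all
qed

lemma twistor_matrix_carrier: "twistor_matrix k n Z B A \<in> carrier_mat k n"
  by (simp add: twistor_matrix_def)

lemma twistor_matrix_entry:
  assumes "r < k" "v < n" "tri r = (a, b, c)"
  shows "twistor_matrix k n Z B A $$ (r, v) =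
    (if v = a then twistor Z A b c else if v = b then - twistor Z A a c
     else if v = c then twistor Z A a b else 0)"
  using assms by (simp add: twistor_matrix_def tri_def)

lemma twistor_matrix_zero:
  assumes "r < k" "v < n" "v \<notin> vertices (tri r)"
  shows "twistor_matrix k n Z B A $$ (r, v) = 0"
proof -
  obtain a b c where t: "tri r = (a, b, c)" by (cases "tri r")
  show ?thesis
    using assms(3) unfolding twistor_matrix_entry[OF assms(1,2) t] by (simp add: t vertices_def)
qed

lemma twistor_matrix_sgn:
  assumes sgn: "\<And>i j. black_arc B i j \<Longrightarrow> i < j \<Longrightarrow> sgn (twistor Z A i j) = \<sigma> * (- 1) ^ area n B i j"
    and r: "r < k" "v \<in> vertices (tri r)"
  shows "sgn (twistor_matrix k n Z B A $$ (r, v)) =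
    \<sigma> * of_int (\<Prod>s\<in>{..<k} - {r}. neg_if (beneath (tri r) (tri s) v))"
proof -
  obtain a b c where t: "tri r = (a, b, c)" by (cases "tri r")
  note ord = black_arc_tri[OF r(1) t]
  have bound: "a < n" "b < n" "c < n" using ord(4-7) by linarith+
  have distinct: "b \<noteq> a" "c \<noteq> a" "c \<noteq> b" using ord(4-6) by auto
  have entries: "twistor_matrix k n Z B A $$ (r, a) = twistor Z A b c"
      "twistor_matrix k n Z B A $$ (r, b) = - twistor Z A a c"
      "twistor_matrix k n Z B A $$ (r, c) = twistor Z A a b"
    unfolding twistor_matrix_entry[OF r(1) bound(1) t] twistor_matrix_entry[OF r(1) bound(2) t]
      twistor_matrix_entry[OF r(1) bound(3) t] by (simp_all only: distinct refl if_True if_False)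
  have "v = a \<or> v = b \<or> v = c" using r(2) by (simp add: t vertices_def)
  then show ?thesis
  proof (elim disjE)
    assume v: "v = a"
    show ?thesis unfolding v entries(1) prod_beneath(1)[OF r(1) t] sgn[OF ord(2,5)] by simp
  next
    assume v: "v = b"
    show ?thesis unfolding v entries(2) prod_beneath(2)[OF r(1) t] sgn_minus sgn[OF ord(3,6)] by simp
  next
    assume v: "v = c"
    show ?thesis unfolding v entries(3) prod_beneath(3)[OF r(1) t] sgn[OF ord(1,4)] by simp
  qed
qed

lemma twistor_matrix_row:
  assumes Z: "Z \<in> carrier_mat n q" and r: "r < k" "tri r = (a, b, c)"
  shows "row (twistor_matrix k n Z B A * Z) r =
    twistor Z A b c \<cdot>\<^sub>v row Z a - twistor Z A a c \<cdot>\<^sub>v row Z b + twistor Z A a b \<cdot>\<^sub>v row Z c"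
proof (rule eq_vecI)
  note ord = black_arc_tri(4-7)[OF r]
  have distinct: "b \<noteq> a" "c \<noteq> a" "c \<noteq> b" using ord(1-3) by auto
  have bound: "a < n" "b < n" using ord by linarith+
  let ?C = "twistor_matrix k n Z B A"
  fix m assume "m < dim_vec (twistor Z A b c \<cdot>\<^sub>v row Z a - twistor Z A a c \<cdot>\<^sub>v row Z b + twistor Z A a b \<cdot>\<^sub>v row Z c)"
  then have m: "m < q" using Z by simp
  have "row (?C * Z) r $ m = (\<Sum>l = 0..<n. ?C $$ (r, l) * Z $$ (l, m))"
    using Z r(1) m twistor_matrix_carrier[of Z A] by (auto simp: scalar_prod_def)
  also have "\<dots> = (\<Sum>l\<in>{a, b, c}. ?C $$ (r, l) * Z $$ (l, m))"
    using ord bound twistor_matrix_entry[OF r(1) _ r(2)]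
    by (intro sum.mono_neutral_right) auto
  also have "\<dots> = ?C $$ (r, a) * Z $$ (a, m) + ?C $$ (r, b) * Z $$ (b, m) + ?C $$ (r, c) * Z $$ (c, m)"
    using distinct by (simp add: add.assoc)
  also have "\<dots> = twistor Z A b c * Z $$ (a, m) - twistor Z A a c * Z $$ (b, m) + twistor Z A a b * Z $$ (c, m)"
    using distinct bound ord(4) by (simp add: twistor_matrix_entry[OF r(1) _ r(2)])
  finally show "row (?C * Z) r $ m = (twistor Z A b c \<cdot>\<^sub>v row Z a - twistor Z A a c \<cdot>\<^sub>v row Z b
      + twistor Z A a b \<cdot>\<^sub>v row Z c) $ m"
    using Z m bound ord(4) by simp
qed (use Z in simp)

text \<open>
  The core of the converse direction, for a representative \<open>A\<close> that has the right signs up to a common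
  factor \<open>\<sigma>\<close>.
\<close>

lemma twistor_matrix_in_cell:
  assumes Z: "Z \<in> Mat_pos n (k + 2)" and k: "k > 0"
    and A: "A \<in> carrier_mat k (k + 2)"
    and sgn: "\<And>i j. black_arc B i j \<Longrightarrow> i < j \<Longrightarrow> sgn (twistor Z A i j) = \<sigma> * (- 1) ^ area n B i j"
    and \<sigma>: "\<sigma> = 1 \<or> \<sigma> = - 1"
  obtains V where "V \<in> cell_G k n B" "represents k n (twistor_matrix k n Z B A) V"
    "represents k (k + 2) (twistor_matrix k n Z B A * Z) (vec_space.row_space (k + 2) A)"
    "Z_tilde Z V = vec_space.row_space (k + 2) A"
proof
  define C where "C = twistor_matrix k n Z B A"
  define V where "V = vec_space.row_space n C"
  define \<epsilon> :: real where "\<epsilon> = \<sigma> ^ k * of_int total_sign"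
  \<comment> \<open>the common sign of all minors is absorbed into the first row\<close>
  define H where "H = multrow_mat k 0 \<epsilon>"
  have C: "C \<in> carrier_mat k n" unfolding C_def by (rule twistor_matrix_carrier)
  have Zc: "Z \<in> carrier_mat n (k + 2)" using Z by (simp add: Mat_pos_def)
  have \<epsilon>: "\<epsilon> * \<epsilon> = 1"
  proof -
    have "\<sigma> ^ k = 1 \<or> \<sigma> ^ k = - 1" using \<sigma> by (cases "even k") auto
    then show ?thesis using total_sign_cases unfolding \<epsilon>_def by auto
  qed
  have H: "H \<in> carrier_mat k k" by (simp add: H_def multrow_mat_def)
  have det_H: "det H = \<epsilon>" unfolding H_def by (rule det_multrow_mat[OF k])
  then have det_H_nz: "det H \<noteq> 0" using \<epsilon> by auto
  have HC: "H * C \<in> carrier_mat k n" using H C by simp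
  have sgn_HC: "sgn (plucker (H * C) I) = (if I \<in> black_matchings n B then 1 else 0)"
    if I: "I \<subseteq> {..<n}" "card I = k" for I
  proof -
    have "sgn (plucker C I) = (if I \<in> black_matchings n B then \<epsilon> else 0)"
      unfolding \<epsilon>_def
    proof (rule kasteleyn_plucker[OF C _ _ \<sigma> I])
      fix r v
      show "C $$ (r, v) = 0" if "r < k" "v < n" "v \<notin> vertices (tri r)"
        unfolding C_def using that by (rule twistor_matrix_zero)
      show "sgn (C $$ (r, v)) = \<sigma> * of_int (\<Prod>s\<in>{..<k} - {r}. neg_if (beneath (tri r) (tri s) v))"
        if "r < k" "v \<in> vertices (tri r)"
        unfolding C_def using sgn that by (rule twistor_matrix_sgn)
    qed
    moreover have "sgn \<epsilon> = \<epsilon>" using \<epsilon> by (auto simp: sgn_if square_eq_1_iff)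
    ultimately show ?thesis using \<epsilon> by (simp add: plucker_mult[OF C H I] det_H sgn_mult)
  qed
  have cell: "(I \<in> black_matchings n B \<longrightarrow> plucker (H * C) I > 0) \<and>
      (I \<notin> black_matchings n B \<longrightarrow> plucker (H * C) I = 0)"
    if "I \<subseteq> {..<n}" "card I = k" for I
    using sgn_HC[OF that] by (auto simp: sgn_if split: if_splits)
  have V_HC: "vec_space.row_space n (H * C) = V"
    unfolding V_def by (rule row_space_mult_invertible[OF C H det_H_nz])
  obtain a b c where "tri 0 = (a, b, c)" by (cases "tri 0")
  from black_arc_tri[OF k this] have arc: "black_arc B a b" "a < b" by blast+
  obtain I where I: "I \<in> black_matchings n B" using matching_avoiding_arc[OF arc] by blast
  note I' = black_matchings_card[OF I]
  have "V \<in> Gr k n"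
    unfolding V_HC[symmetric] using cell[OF I'] I by (intro plucker_nonzero_in_Gr[OF HC I']) auto
  then have rep_C: "represents k n C V" and rep_HC: "represents k n (H * C) V"
    using C HC V_HC by (auto simp: represents_def V_def)
  show "represents k n (twistor_matrix k n Z B A) V" using rep_C by (simp add: C_def)
  have "plucker (H * C) I \<ge> 0" if "I \<subseteq> {..<n}" "card I = k" for I
    using cell[OF that] by force
  then have "V \<in> Gr_nonneg k n"
    unfolding Gr_nonneg_def using \<open>V \<in> Gr k n\<close> rep_HC by blast
  then show "V \<in> cell_G k n B"
    unfolding cell_G_def positroid_cell_def using rep_HC cell by blast
  have CZ: "C * Z \<in> carrier_mat k (k + 2)" using C Zc by simp
  have twistor_nz: "det (border A (row Z i) (row Z j)) \<noteq> 0" if "black_arc B i j" "i < j" for i j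
  proof -
    have "sgn (twistor Z A i j) \<noteq> 0" using sgn[OF that] \<sigma> by auto
    then show ?thesis using twistor_eq_det_border[OF A] Zc by (auto simp: sgn_if)
  qed
  have row_Z: "row Z i \<in> carrier_vec (k + 2)" for i using row_carrier[of Z i] Zc by simp
  have "row (C * Z) r \<in> vec_space.row_space (k + 2) A" if r: "r < k" for r
  proof -
    obtain a b c where t: "tri r = (a, b, c)" by (cases "tri r")
    note arc = black_arc_tri[OF r t]
    have "dim_col Z = k + 2" using Zc by simp
    note tw = twistor_eq_det_border[OF A this]
    show ?thesis
      unfolding C_def twistor_matrix_row[OF Zc r t] tw
      by (rule three_term_in_row_space[OF A row_Z row_Z row_Z twistor_nz[OF arc(2,5)]])
  qed
  then obtain G where G: "G \<in> carrier_mat k k" "C * Z = G * A"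
    using rows_in_row_space_factor[OF A CZ] by blast
  \<comment> \<open>\<open>H * C\<close> has the minors of a point of the cell, so this number is not zero and \<open>G\<close> is invertible\<close>
  have "twistor Z (H * C * Z) a b = det H * det G * twistor Z A a b"
  proof -
    have "H * C * Z = H * (G * A)" using assoc_mult_mat[OF H C Zc] G(2) by simp
    then show ?thesis
      using Zc twistor_eq_det_border[of "H * (G * A)" k "k + 2" Z] twistor_eq_det_border[OF A, of Z]
        det_border_mult[OF A G(1)] det_border_mult[of "G * A" k H] A G(1) H by simp
  qed
  moreover have "sgn (twistor Z (H * C * Z) a b) = (- 1) ^ area n B a b"
    by (rule twistor_sign_of_cell[OF HC Z _ arc]) (rule cell)
  ultimately have "det G \<noteq> 0" by auto
  then have CZ_A: "vec_space.row_space (k + 2) (C * Z) = vec_space.row_space (k + 2) A"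
    unfolding G(2) by (rule row_space_mult_invertible[OF A G(1)])
  have "vec_space.row_space (k + 2) A \<in> Gr k (k + 2)"
    by (rule border_nonzero_in_Gr[OF A row_Z row_Z twistor_nz[OF arc]])
  then show "represents k (k + 2) (twistor_matrix k n Z B A * Z) (vec_space.row_space (k + 2) A)"
    using CZ CZ_A by (simp add: represents_def C_def)
  show "Z_tilde Z V = vec_space.row_space (k + 2) A"
    using Z_tilde_represents[OF rep_C Zc] CZ_A by simp
qed

lemma image_representative:
  assumes Z: "Z \<in> Mat_pos n (k + 2)" and k: "k > 0" and Y: "Y \<in> Z_image_G k n Z B"
  obtains C where "represents k (k + 2) (C * Z) Y"
    "\<And>i j. black_arc B i j \<Longrightarrow> i < j \<Longrightarrow> sgn (twistor Z (C * Z) i j) = (- 1) ^ area n B i j"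
proof -
  have Zc: "Z \<in> carrier_mat n (k + 2)" using Z by (simp add: Mat_pos_def)
  obtain V where V: "V \<in> cell_G k n B" "Y = Z_tilde Z V" using Y by (auto simp: Z_image_G_def)
  then obtain C where rep: "represents k n C V"
    and cell: "\<And>I. I \<subseteq> {..<n} \<Longrightarrow> card I = k \<Longrightarrow>
      (I \<in> black_matchings n B \<longrightarrow> plucker C I > 0) \<and> (I \<notin> black_matchings n B \<longrightarrow> plucker C I = 0)"
    unfolding cell_G_def positroid_cell_def by blast
  have C: "C \<in> carrier_mat k n" using rep by (simp add: represents_def)
  have CZ: "C * Z \<in> carrier_mat k (k + 2)" using C Zc by simp
  have sgn: "sgn (twistor Z (C * Z) i j) = (- 1) ^ area n B i j" if "black_arc B i j" "i < j" for i j
    by (rule twistor_sign_of_cell[OF C Z _ that]) (rule cell)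
  obtain a b c where "tri 0 = (a, b, c)" by (cases "tri 0")
  from black_arc_tri[OF k this] have arc: "black_arc B a b" "a < b" by blast+
  have "twistor Z (C * Z) a b \<noteq> 0" using sgn[OF arc] by auto
  then have "det (border (C * Z) (row Z a) (row Z b)) \<noteq> 0"
    using twistor_eq_det_border[OF CZ] Zc by simp
  moreover have row_Z: "row Z i \<in> carrier_vec (k + 2)" for i using row_carrier[of Z i] Zc by simp
  ultimately have "vec_space.row_space (k + 2) (C * Z) \<in> Gr k (k + 2)"
    using border_nonzero_in_Gr[OF CZ row_Z row_Z] by blast
  moreover have "Y = vec_space.row_space (k + 2) (C * Z)"
    unfolding V(2) by (rule Z_tilde_represents[OF rep Zc])
  ultimately have "represents k (k + 2) (C * Z) Y" using CZ by (simp add: represents_def)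
  then show thesis using that sgn by blast
qed

end

theorem theorem4p28:
  fixes k n :: nat and Z :: "real mat" and D B :: "nat set set"
  assumes "k > 0" and "n > 0" and "k + 2 \<le> n"
    and "Z \<in> Mat_pos n (k + 2)"
    and "bicolored_triangulation k n D B"
  shows "Z_image_G k n Z B =
      {Y \<in> Gr k (k + 2). \<exists>A. represents k (k + 2) A Y \<and>
         (\<forall>i j. black_arc B i j \<and> i < j \<longrightarrow> sgn (twistor Z A i j) = (- 1) ^ area n B i j)} \<and>
    (\<forall>Y \<in> Z_image_G k n Z B. \<forall>A. represents k (k + 2) A Y \<longrightarrow>
      (\<exists>V \<in> cell_G k n B. represents k n (twistor_matrix k n Z B A) V) \<and>
      represents k (k + 2) (twistor_matrix k n Z B A * Z) Y)"
proof -
  interpret bicolored k n D B using assms(5) by unfold_locales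
  note k = assms(1) and Z = assms(4)
  have Zc: "Z \<in> carrier_mat n (k + 2)" using Z by (simp add: Mat_pos_def)
  have "Z_image_G k n Z B \<subseteq> {Y \<in> Gr k (k + 2). \<exists>A. represents k (k + 2) A Y \<and>
      (\<forall>i j. black_arc B i j \<and> i < j \<longrightarrow> sgn (twistor Z A i j) = (- 1) ^ area n B i j)}"
  proof
    fix Y assume "Y \<in> Z_image_G k n Z B"
    then obtain C where C: "represents k (k + 2) (C * Z) Y"
      "\<And>i j. black_arc B i j \<Longrightarrow> i < j \<Longrightarrow> sgn (twistor Z (C * Z) i j) = (- 1) ^ area n B i j"
      using image_representative[OF Z k] by blast
    moreover from this have "Y \<in> Gr k (k + 2)" by (simp add: represents_def)
    ultimately show "Y \<in> {Y \<in> Gr k (k + 2). \<exists>A. represents k (k + 2) A Y \<and>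
      (\<forall>i j. black_arc B i j \<and> i < j \<longrightarrow> sgn (twistor Z A i j) = (- 1) ^ area n B i j)}"
      by blast
  qed
  moreover have "{Y \<in> Gr k (k + 2). \<exists>A. represents k (k + 2) A Y \<and>
      (\<forall>i j. black_arc B i j \<and> i < j \<longrightarrow> sgn (twistor Z A i j) = (- 1) ^ area n B i j)}
      \<subseteq> Z_image_G k n Z B"
  proof
    fix Y assume "Y \<in> {Y \<in> Gr k (k + 2). \<exists>A. represents k (k + 2) A Y \<and>
      (\<forall>i j. black_arc B i j \<and> i < j \<longrightarrow> sgn (twistor Z A i j) = (- 1) ^ area n B i j)}"
    then obtain A where A: "A \<in> carrier_mat k (k + 2)" "Y = vec_space.row_space (k + 2) A"
      and sgn: "\<And>i j. black_arc B i j \<Longrightarrow> i < j \<Longrightarrow> sgn (twistor Z A i j) = 1 * (- 1) ^ area n B i j"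
      by (auto simp: represents_def)
    obtain V where "V \<in> cell_G k n B" "Z_tilde Z V = Y"
      using twistor_matrix_in_cell[OF Z k A(1) sgn] A(2) by blast
    then show "Y \<in> Z_image_G k n Z B" unfolding Z_image_G_def by blast
  qed
  moreover have "(\<exists>V \<in> cell_G k n B. represents k n (twistor_matrix k n Z B A) V) \<and>
      represents k (k + 2) (twistor_matrix k n Z B A * Z) Y"
    if Y: "Y \<in> Z_image_G k n Z B" and rep: "represents k (k + 2) A Y" for Y A
  proof -
    obtain C where C: "represents k (k + 2) (C * Z) Y"
      and sgn_C: "\<And>i j. black_arc B i j \<Longrightarrow> i < j \<Longrightarrow> sgn (twistor Z (C * Z) i j) = (- 1) ^ area n B i j"
      using image_representative[OF Z k Y] by blast
    have A: "A \<in> carrier_mat k (k + 2)" "Y = vec_space.row_space (k + 2) A"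
      and CZ: "C * Z \<in> carrier_mat k (k + 2)" "Y = vec_space.row_space (k + 2) (C * Z)"
      using rep C by (auto simp: represents_def)
    have "row (C * Z) i \<in> vec_space.row_space (k + 2) A" if "i < k" for i
      using row_in_row_space[OF CZ(1) that] A(2) CZ(2) by simp
    then obtain G where G: "G \<in> carrier_mat k k" "C * Z = G * A"
      using rows_in_row_space_factor[OF A(1) CZ(1)] by blast
    \<comment> \<open>\<open>A\<close> need not have the right signs itself, but it differs from \<open>C * Z\<close> by the matrix \<open>G\<close>\<close>
    define \<sigma> where "\<sigma> = sgn (det G)"
    have twistor: "twistor Z (C * Z) i j = det G * twistor Z A i j" for i j
      using twistor_eq_det_border[OF A(1)] twistor_eq_det_border[OF CZ(1)]
        det_border_mult[OF A(1) G(1)] G(2) Zc by simp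
    obtain a b c where "tri 0 = (a, b, c)" by (cases "tri 0")
    from black_arc_tri[OF k this] have "black_arc B a b" "a < b" by blast+
    from sgn_C[OF this] have "det G \<noteq> 0" unfolding twistor by auto
    then have \<sigma>: "\<sigma> = 1 \<or> \<sigma> = - 1" by (auto simp: \<sigma>_def sgn_if)
    have "sgn (twistor Z A i j) = \<sigma> * (- 1) ^ area n B i j" if "black_arc B i j" "i < j" for i j
      using sgn_C[OF that] \<sigma> unfolding twistor sgn_mult \<sigma>_def[symmetric] by auto
    from twistor_matrix_in_cell[OF Z k A(1) this \<sigma>] A(2) show ?thesis by blast
  qed
  ultimately show ?thesis by blast
qed

end
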